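(* Fix $p\in(0,1)$. For each $n$, let $G_{n,p}$ be the Erdős–Rényi random graph on $n$ vertices (each of the $\binom{n}{2}$ possible edges present independently with probability $p$). Let $x_1\ge \cdots \ge x_n$ be the roots of the matching polynomial $m(G_{n,p},x)$, let $\lambda_i=x_i/\sqrt{np}$, and let $F_n(x)=\frac{1}{n}\left|\{i:\lambda_i\le x\}\right|$ be the empirical matching distribution. Then $F_n$ converges weakly almost surely to the standard semicircle distribution $F_{sc}$, whose density is $\rho_{sc}(x)=\frac{1}{2\pi}\sqrt{4-x^2}$ for $|x|\le 2$ and $0$ otherwise; that is, for every bounded continuous function $f:\mathbb{R}\to\mathbb{R}$, $$\int_{\mathbb{R}} f\,dF_n(x)\longrightarrow \int_{\mathbb{R}} f\,dF_{sc}(x)\quad\text{almost surely as } n\to\infty.$$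
   Context: For a finite simple graph $G$ of order $n$, let $m_k(G)$ be the number of $k$-matchings (sets of $k$ pairwise disjoint edges) of $G$, with $m_0(G)=1$. The matching polynomial is $m(G,x)=\sum_{k=0}^{\lfloor n/2\rfloor}(-1)^k m_k(G)x^{n-2k}$; all its roots are real. *)

theory Defs
  imports
    "HOL-Computational_Algebra.Polynomial"
    "HOL-Probability.Probability"
begin

text \<open>A finite simple graph is given by a finite vertex set \<open>V\<close> and an edge set
  \<open>E \<subseteq> complete_edges V\<close>.\<close>

definition complete_edges :: "'a set \<Rightarrow> 'a set set" where
  "complete_edges V = {e. e \<subseteq> V \<and> card e = 2}"

definition k_matchings :: "'a set set \<Rightarrow> nat \<Rightarrow> 'a set set set" where
  "k_matchings E k = {S. S \<subseteq> E \<and> card S = k \<and> pairwise disjnt S}"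

definition matching_poly :: "'a set \<Rightarrow> 'a set set \<Rightarrow> real poly" where
  "matching_poly V E =
     (\<Sum>k = 0..card V div 2.
        monom ((-1) ^ k * real (card (k_matchings E k))) (card V - 2 * k))"

text \<open>The real roots of the matching polynomial in decreasing order, repeated according to
  multiplicity. The entry at position \<open>i\<close> is the root usually written with index \<open>i + 1\<close>; all
  roots being real, the list has length \<open>card V\<close> if \<open>V\<close> is finite and
  \<open>E \<subseteq> complete_edges V\<close>.\<close>

definition matching_roots :: "'a set \<Rightarrow> 'a set set \<Rightarrow> real list" where
  "matching_roots V E = rev (sorted_list_of_multiset (proots (matching_poly V E)))"

definition emp_matching_cdf :: "real \<Rightarrow> 'a set \<Rightarrow> 'a set set \<Rightarrow> real \<Rightarrow> real" where
  "emp_matching_cdf p V E x =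
     real (card {i. i < length (matching_roots V E) \<and>
                    matching_roots V E ! i / sqrt (real (card V) * p) \<le> x}) / real (card V)"

text \<open>\<open>G\<close> is an Erdos-Renyi random graph on the vertex set \<open>{..<n}\<close>, defined on the probability
  space \<open>M\<close>. The events \<open>e \<in> G\<close> determine \<open>G\<close>, so this fixes its law; measurability of these
  events is part of \<open>indep_events\<close>.\<close>

definition erdos_renyi ::
    "'w measure \<Rightarrow> nat \<Rightarrow> real \<Rightarrow> ('w \<Rightarrow> nat set set) \<Rightarrow> bool" where
  "erdos_renyi M n p G \<longleftrightarrow>
     prob_space M \<and>
     (\<forall>\<omega>\<in>space M. G \<omega> \<subseteq> complete_edges {..<n}) \<and>
     (\<forall>e\<in>complete_edges {..<n}. measure M {\<omega>\<in>space M. e \<in> G \<omega>} = p) \<and>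
     prob_space.indep_events M (\<lambda>e. {\<omega>\<in>space M. e \<in> G \<omega>}) (complete_edges {..<n})"

definition semicircle_density :: "real \<Rightarrow> real" where
  "semicircle_density x = (if \<bar>x\<bar> \<le> 2 then 1 / (2 * pi) * sqrt (4 - x\<^sup>2) else 0)"

definition semicircle_measure :: "real measure" where
  "semicircle_measure = density lborel (\<lambda>x. ennreal (semicircle_density x))"

end

theory Submission
  imports
    Defs
    "HOL-Computational_Algebra.Fundamental_Theorem_Algebra"
begin

text \<open>
  Write \<open>R\<^sub>v(G, z) = m(G - v, z) / m(G, z)\<close>. The vertex recurrence for the matching polynomial reads
  \<open>1 / R\<^sub>v(G, z) = z - (\<Sum>u \<sim> v. R\<^sub>u(G - v, z))\<close>, and \<open>m'(G, z) / m(G, z) = (\<Sum>v. R\<^sub>v(G, z))\<close> is the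
  Stieltjes transform of the root counting measure. The recurrence maps the lower half plane to
  itself, so all roots are real, and for real \<open>z\<close> with \<open>z\<^sup>2 \<ge> 4 \<Delta>\<close> it keeps \<open>R\<^sub>v\<close> in \<open>(0, 2 / z]\<close>,
  so the roots are bounded by \<open>2 \<surd>\<Delta>\<close>. If every degree is close to \<open>d\<close>, then for \<open>z \<ge> 4 \<surd>d\<close>
  the recurrence is a contraction towards the solution of \<open>\<sigma> (z - d \<sigma>) = 1\<close>, which is the rescaled Stieltjes transform of
  the semicircle distribution. Hence the semicircle law holds for every sequence of nearly regular
  graphs, and randomness enters only through Hoeffding's inequality and the Borel-Cantelli lemma,
  which show that almost surely all degrees of \<open>G\<^bsub>n,p\<^esub>\<close> are \<open>(1 + o(1)) n p\<close>.
\<close>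

section \<open>The matching polynomial of induced subgraphs\<close>

text \<open>The edge set stays fixed and an induced subgraph is given by its vertex set alone, so
  deleting vertices leaves \<open>E\<close> untouched.\<close>

definition matchings :: "'a set set \<Rightarrow> 'a set \<Rightarrow> 'a set set set" where
  "matchings E V = {S. S \<subseteq> E \<and> \<Union>S \<subseteq> V \<and> pairwise disjnt S}"

text \<open>The exponent counts uncovered vertices, which avoids truncated subtraction and suits
  vertex deletion. The ring is left open because the sum is taken at real and complex points and at
  the indeterminate \<open>[:0, 1:]\<close>.\<close>

definition matching_sum :: "'a set set \<Rightarrow> 'a set \<Rightarrow> 'b \<Rightarrow> 'b::comm_ring_1" where
  "matching_sum E V z = (\<Sum>S\<in>matchings E V. (-1) ^ card S * z ^ card (V - \<Union>S))"

definition neighbours :: "'a set set \<Rightarrow> 'a set \<Rightarrow> 'a \<Rightarrow> 'a set" where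
  "neighbours E V v = {u\<in>V. {u, v} \<in> E}"

lemma finite_matchings: "finite V \<Longrightarrow> finite (matchings E V)"
  by (rule finite_subset[of _ "Pow (Pow V)"]) (auto simp: matchings_def)

lemma finite_neighbours [simp]: "finite V \<Longrightarrow> finite (neighbours E V v)"
  by (simp add: neighbours_def)

lemma matching_sum_empty [simp]:
  assumes "\<forall>e\<in>E. card e = 2"
  shows "matching_sum E {} z = 1"
proof -
  have "matchings E {} = {{}}"
    using assms by (fastforce simp: matchings_def)
  then show ?thesis
    by (simp add: matching_sum_def)
qed

text \<open>Disjointness allows at most one edge at \<open>v\<close>, and once \<open>{u, v}\<close>
  is chosen no other edge meets \<open>u\<close> or \<open>v\<close>.\<close>

lemma matchings_split:
  assumes "v \<in> V" and E: "\<forall>e\<in>E. card e = 2"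
  shows "matchings E V = matchings E (V - {v}) \<union>
    (\<Union>u\<in>neighbours E V v. insert {u, v} ` matchings E (V - {v} - {u}))" (is "_ = ?A \<union> ?B")
proof (intro equalityI subsetI)
  fix S assume S: "S \<in> matchings E V"
  show "S \<in> ?A \<union> ?B"
  proof (cases "v \<in> \<Union>S")
    case False
    with S show ?thesis
      by (auto simp: matchings_def)
  next
    case True
    then obtain e where e: "e \<in> S" "v \<in> e"
      by auto
    with S E have "card e = 2"
      by (auto simp: matchings_def)
    with e obtain u where u: "e = {u, v}" "u \<noteq> v"
      by (auto simp: card_2_iff)
    have "disjnt e f" if "f \<in> S - {e}" for f
      using S e that unfolding matchings_def by (blast dest: pairwiseD)
    then have "u \<notin> f \<and> v \<notin> f" if "f \<in> S - {e}" for f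
      using that u by (force simp: disjnt_def)
    then have "\<Union>(S - {e}) \<subseteq> V - {v} - {u}"
      using S by (auto simp: matchings_def)
    then have "S - {e} \<in> matchings E (V - {v} - {u})"
      using S by (auto simp: matchings_def intro: pairwise_subset)
    moreover have "u \<in> neighbours E V v"
      using S e u by (auto simp: matchings_def neighbours_def)
    moreover have "S = insert {u, v} (S - {e})"
      using e u by auto
    ultimately show ?thesis
      by (intro UnI2 UN_I[of u] image_eqI[of _ _ "S - {e}"])
  qed
next
  fix S assume "S \<in> ?A \<union> ?B"
  then show "S \<in> matchings E V"
  proof
    assume "S \<in> ?A"
    then show ?thesis
      by (auto simp: matchings_def)
  next
    assume "S \<in> ?B"
    then obtain u T where "u \<in> V" "{u, v} \<in> E" "T \<in> matchings E (V - {v} - {u})"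
      and S: "S = insert {u, v} T"
      by (auto simp: neighbours_def)
    moreover from this have "\<forall>f\<in>T. disjnt {u, v} f \<and> disjnt f {u, v}"
      unfolding matchings_def disjnt_def by blast
    ultimately show ?thesis
      using \<open>v \<in> V\<close> by (auto simp: S matchings_def pairwise_insert)
  qed
qed

text \<open>Matchings are sorted by the partner of \<open>v\<close>: an unmatched \<open>v\<close>
  contributes one more factor \<open>z\<close>, while an edge \<open>{u, v}\<close> covers both ends
  and contributes one sign change.\<close>

lemma matching_sum_recurrence:
  assumes fin: "finite V" and "v \<in> V" and E: "\<forall>e\<in>E. card e = 2"
  shows "matching_sum E V z = z * matching_sum E (V - {v}) z
    - (\<Sum>u\<in>neighbours E V v. matching_sum E (V - {v} - {u}) z)"
proof -
  let ?f = "\<lambda>S. (-1) ^ card S * z ^ card (V - \<Union>S)"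
  let ?B = "\<lambda>u. insert {u, v} ` matchings E (V - {v} - {u})"
  have finB: "finite (?B u)" for u
    by (simp add: finite_matchings fin)
  have nv: "u \<noteq> v" if "u \<in> neighbours E V v" for u
    using that E by (auto simp: neighbours_def)
  have "matching_sum E V z = sum ?f (matchings E (V - {v})) + sum ?f (\<Union>u\<in>neighbours E V v. ?B u)"
    unfolding matching_sum_def matchings_split[OF \<open>v \<in> V\<close> E]
  proof (rule sum.union_disjoint)
    have "S \<notin> ?B u" if "S \<in> matchings E (V - {v})" for S u
      using that by (auto simp: matchings_def)
    then show "matchings E (V - {v}) \<inter> (\<Union>u\<in>neighbours E V v. ?B u) = {}"
      by blast
  qed (use fin finB in \<open>simp_all add: finite_matchings\<close>)
  also have "sum ?f (matchings E (V - {v})) = z * matching_sum E (V - {v}) z"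
    unfolding matching_sum_def sum_distrib_left
  proof (rule sum.cong[OF refl])
    fix S assume S: "S \<in> matchings E (V - {v})"
    have "V - \<Union>S = insert v (V - {v} - \<Union>S)"
      using S \<open>v \<in> V\<close> by (auto simp: matchings_def)
    then have "card (V - \<Union>S) = Suc (card (V - {v} - \<Union>S))"
      using fin by simp
    then show "?f S = z * ((-1) ^ card S * z ^ card (V - {v} - \<Union>S))"
      by (simp add: mult_ac)
  qed
  also have "sum ?f (\<Union>u\<in>neighbours E V v. ?B u) = (\<Sum>u\<in>neighbours E V v. sum ?f (?B u))"
  proof (rule sum.UNION_disjoint)
    show "\<forall>u\<in>neighbours E V v. \<forall>w\<in>neighbours E V v. u \<noteq> w \<longrightarrow> ?B u \<inter> ?B w = {}"
    proof (intro ballI impI, rule ccontr)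
      fix u w assume uw: "u \<in> neighbours E V v" "w \<in> neighbours E V v" "u \<noteq> w"
        and "?B u \<inter> ?B w \<noteq> {}"
      then obtain S T where ST: "insert {u, v} S = insert {w, v} T"
        and S: "S \<in> matchings E (V - {v} - {u})"
        by auto
      have "{w, v} \<in> insert {u, v} S"
        unfolding ST by simp
      then have "{w, v} \<in> S"
        using uw(3) nv[OF uw(1)] nv[OF uw(2)] by (auto simp: doubleton_eq_iff)
      with S show False
        by (auto simp: matchings_def)
    qed
  qed (use fin finB in auto)
  also have "\<dots> = (\<Sum>u\<in>neighbours E V v. - matching_sum E (V - {v} - {u}) z)"
  proof (rule sum.cong[OF refl])
    fix u assume u: "u \<in> neighbours E V v"
    have notin: "{u, v} \<notin> S" if "S \<in> matchings E (V - {v} - {u})" for S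
      using that by (auto simp: matchings_def)
    have "inj_on (insert {u, v}) (matchings E (V - {v} - {u}))"
      using notin by (intro inj_onI) (metis insert_ident)
    then have "sum ?f (?B u) = (\<Sum>S\<in>matchings E (V - {v} - {u}). ?f (insert {u, v} S))"
      by (simp add: sum.reindex)
    also have "\<dots> = (\<Sum>S\<in>matchings E (V - {v} - {u}).
        - ((-1) ^ card S * z ^ card (V - {v} - {u} - \<Union>S)))"
    proof (rule sum.cong[OF refl])
      fix S assume S: "S \<in> matchings E (V - {v} - {u})"
      have "finite S"
        by (rule finite_subset[of _ "Pow V"]) (use S fin in \<open>auto simp: matchings_def\<close>)
      moreover have "V - \<Union>(insert {u, v} S) = V - {v} - {u} - \<Union>S"
        by auto
      ultimately show "?f (insert {u, v} S) = - ((-1) ^ card S * z ^ card (V - {v} - {u} - \<Union>S))"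
        using notin[OF S] by (simp add: card_insert_disjoint)
    qed
    finally show "sum ?f (?B u) = - matching_sum E (V - {v} - {u}) z"
      by (simp add: matching_sum_def sum_negf)
  qed
  finally show ?thesis
    by (simp add: sum_negf)
qed

text \<open>Differentiating \<open>z ^ m\<close> gives one copy of \<open>z ^ (m - 1)\<close> for
  each of the \<open>m\<close> uncovered vertices. Exchanging the sums collects, for each
  \<open>v\<close>, the matchings that miss \<open>v\<close>.\<close>

lemma matching_sum_deriv:
  fixes z :: real
  assumes fin: "finite V"
  shows "(matching_sum E V has_field_derivative (\<Sum>v\<in>V. matching_sum E (V - {v}) z)) (at z)"
proof -
  have "(matching_sum E V has_field_derivative
      (\<Sum>S\<in>matchings E V. (-1) ^ card S * (of_nat (card (V - \<Union>S)) * z ^ (card (V - \<Union>S) - 1)))) (at z)"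
    unfolding matching_sum_def [abs_def]
    by (auto intro!: derivative_eq_intros sum.cong)
  also have "(\<Sum>S\<in>matchings E V. (-1) ^ card S * (of_nat (card (V - \<Union>S)) * z ^ (card (V - \<Union>S) - 1)))
    = (\<Sum>S\<in>matchings E V. \<Sum>v\<in>{v\<in>V. v \<notin> \<Union>S}. (-1) ^ card S * z ^ card (V - {v} - \<Union>S))"
  proof (rule sum.cong[OF refl])
    fix S assume S: "S \<in> matchings E V"
    have "(\<Sum>v\<in>{v\<in>V. v \<notin> \<Union>S}. (-1) ^ card S * z ^ card (V - {v} - \<Union>S))
      = (\<Sum>v\<in>V - \<Union>S. (-1) ^ card S * z ^ (card (V - \<Union>S) - 1))"
    proof (rule sum.cong)
      fix v assume v: "v \<in> V - \<Union>S"
      then have "V - {v} - \<Union>S = (V - \<Union>S) - {v}"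
        by auto
      then show "(-1) ^ card S * z ^ card (V - {v} - \<Union>S) = (-1) ^ card S * z ^ (card (V - \<Union>S) - 1)"
        using v fin by (simp add: card_Diff_singleton)
    qed auto
    then show "(-1) ^ card S * (of_nat (card (V - \<Union>S)) * z ^ (card (V - \<Union>S) - 1))
      = (\<Sum>v\<in>{v\<in>V. v \<notin> \<Union>S}. (-1) ^ card S * z ^ card (V - {v} - \<Union>S))"
      by simp
  qed
  also have "\<dots> = (\<Sum>v\<in>V. \<Sum>S\<in>{S\<in>matchings E V. v \<notin> \<Union>S}. (-1) ^ card S * z ^ card (V - {v} - \<Union>S))"
    by (rule sum.swap_restrict) (use fin finite_matchings in auto)
  also have "\<dots> = (\<Sum>v\<in>V. matching_sum E (V - {v}) z)"
    unfolding matching_sum_def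
    by (intro sum.cong) (auto simp: matchings_def)
  finally show ?thesis .
qed

lemma matching_card:
  assumes "finite V" "\<forall>e\<in>E. card e = 2" "S \<in> matchings E V"
  shows "card (\<Union>S) = 2 * card S" "2 * card S \<le> card V" "card (V - \<Union>S) = card V - 2 * card S"
proof -
  have sub: "\<Union>S \<subseteq> V" and "finite (\<Union>S)"
    using assms by (auto simp: matchings_def intro: finite_subset)
  have c2: "card e = 2" if "e \<in> S" for e
    using that assms by (auto simp: matchings_def)
  have "card (\<Union>S) = sum card S"
    by (rule card_Union_disjoint)
       (use assms sub in \<open>auto simp: matchings_def intro: finite_subset\<close>)
  also have "\<dots> = 2 * card S"
    using c2 by simp
  finally show *: "card (\<Union>S) = 2 * card S" .
  show "2 * card S \<le> card V"
    using card_mono[OF assms(1) sub] * by simp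
  show "card (V - \<Union>S) = card V - 2 * card S"
    using sub \<open>finite (\<Union>S)\<close> by (simp add: card_Diff_subset *)
qed

text \<open>Edges cover vertices in pairs, so every exponent has the parity of
  \<open>card V\<close>. This symmetry carries results from the upper to the lower half plane and
  from positive to negative roots.\<close>

lemma matching_sum_uminus:
  assumes "finite V" "\<forall>e\<in>E. card e = 2"
  shows "matching_sum E V (- z) = (-1) ^ card V * matching_sum E V z"
  unfolding matching_sum_def sum_distrib_left
proof (rule sum.cong[OF refl])
  fix S assume "S \<in> matchings E V"
  note c = matching_card[OF assms this]
  have "(- z) ^ (card V - 2 * card S) = (-1) ^ (card V - 2 * card S) * z ^ (card V - 2 * card S)"
    by (rule power_minus)
  also have "(-1) ^ (card V - 2 * card S) = ((-1) ^ card V :: 'b)"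
    using c(2) by (auto simp: minus_one_power_iff)
  finally show "(-1) ^ card S * (- z) ^ card (V - \<Union>S)
      = (-1) ^ card V * ((-1) ^ card S * z ^ card (V - \<Union>S))"
    by (simp add: c(3) mult_ac)
qed

section \<open>The matching sum as a polynomial\<close>

lemma complete_edges_card: "E \<subseteq> complete_edges V \<Longrightarrow> \<forall>e\<in>E. card e = 2"
  by (auto simp: complete_edges_def)

text \<open>Grouping the matchings by size identifies the coefficients. With the coefficient ring
  left open, one statement covers both the real polynomial and its complex image.\<close>

lemma matching_sum_monom:
  assumes fin: "finite V" and E: "E \<subseteq> complete_edges V"
  shows "matching_sum E V [:0, 1:] = (\<Sum>k = 0..card V div 2.
    monom ((-1) ^ k * of_nat (card (k_matchings E k))) (card V - 2 * k) :: 'b::comm_ring_1 poly)"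
proof -
  note c2 = complete_edges_card[OF E]
  have UN: "(\<Union>k\<in>{0..card V div 2}. k_matchings E k) = matchings E V"
  proof (intro equalityI subsetI)
    fix S assume "S \<in> (\<Union>k\<in>{0..card V div 2}. k_matchings E k)"
    then show "S \<in> matchings E V"
      using E unfolding k_matchings_def matchings_def complete_edges_def by blast
  next
    fix S assume S: "S \<in> matchings E V"
    then show "S \<in> (\<Union>k\<in>{0..card V div 2}. k_matchings E k)"
      using matching_card(2)[OF fin c2 S] by (auto simp: k_matchings_def matchings_def)
  qed
  have fink: "finite (k_matchings E k)" if "k \<in> {0..card V div 2}" for k
    by (rule finite_subset[OF _ finite_matchings[OF fin, of E]]) (use UN that in auto)
  have "matching_sum E V [:0, 1:]
      = (\<Sum>S\<in>matchings E V. monom ((-1) ^ card S) (card V - 2 * card S) :: 'b poly)"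
    unfolding matching_sum_def
  proof (rule sum.cong[OF refl])
    fix S assume S: "S \<in> matchings E V"
    have "(-1 :: 'b poly) ^ k = [:(-1) ^ k:]" for k
      by (induction k) auto
    then show "(-1) ^ card S * [:0, 1:] ^ card (V - \<Union>S)
        = (monom ((-1) ^ card S) (card V - 2 * card S) :: 'b poly)"
      using matching_card(3)[OF fin c2 S] by (simp add: monom_altdef)
  qed
  also have "\<dots> = (\<Sum>k = 0..card V div 2. \<Sum>S\<in>k_matchings E k.
      monom ((-1) ^ card S) (card V - 2 * card S))"
    unfolding UN[symmetric]
    by (rule sum.UNION_disjoint) (use fink in \<open>auto simp: k_matchings_def\<close>)
  also have "\<dots> = (\<Sum>k = 0..card V div 2. \<Sum>S\<in>k_matchings E k. monom ((-1) ^ k) (card V - 2 * k))"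
    by (intro sum.cong) (auto simp: k_matchings_def)
  finally show ?thesis
    by (simp add: of_nat_monom mult_monom mult.commute)
qed

lemma poly_matching_sum: "poly (matching_sum E V [:0, 1:]) x = matching_sum E V x"
  by (simp add: matching_sum_def poly_sum)

lemma poly_matching_poly:
  assumes "finite V" and "E \<subseteq> complete_edges V"
  shows "poly (matching_poly V E) x = matching_sum E V x"
  unfolding poly_matching_sum[symmetric, of E V x] matching_sum_monom[OF assms] matching_poly_def
  by simp

lemma poly_map_of_real_matching_poly:
  fixes z :: complex
  assumes "finite V" and "E \<subseteq> complete_edges V"
  shows "poly (map_poly of_real (matching_poly V E)) z = matching_sum E V z"
proof -
  have "map_poly of_real (matching_poly V E) = (matching_sum E V [:0, 1:] :: complex poly)"
    unfolding matching_sum_monom[OF assms] matching_poly_def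
    by (rule poly_eqI) (auto simp: coeff_map_poly coeff_sum intro!: sum.cong)
  then show ?thesis
    by (simp add: poly_matching_sum)
qed

lemma matching_poly_monic:
  assumes fin: "finite V" and E: "E \<subseteq> complete_edges V"
  shows "degree (matching_poly V E) = card V" "lead_coeff (matching_poly V E) = 1"
proof -
  have le: "degree (matching_poly V E) \<le> card V"
    unfolding matching_poly_def
    by (rule degree_sum_le) (auto intro: order.trans[OF degree_monom_le])
  have "finite S" if "S \<subseteq> E" for S
    by (rule finite_subset[of _ "Pow V"]) (use that E fin in \<open>auto simp: complete_edges_def\<close>)
  then have k0: "k_matchings E 0 = {{}}"
    by (auto simp: k_matchings_def)
  have "coeff (matching_poly V E) (card V) = (\<Sum>k = 0..card V div 2. if k = 0 then 1 else 0)"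
    unfolding matching_poly_def coeff_sum
    by (rule sum.cong) (auto simp: k0)
  then have *: "coeff (matching_poly V E) (card V) = 1"
    by simp
  with le show "degree (matching_poly V E) = card V"
    by (metis le_antisym le_degree zero_neq_one)
  with * show "lead_coeff (matching_poly V E) = 1"
    by simp
qed

section \<open>Ratios of matching polynomials\<close>

definition matching_ratio :: "'a set set \<Rightarrow> 'a set \<Rightarrow> 'b \<Rightarrow> 'a \<Rightarrow> 'b::field" where
  "matching_ratio E V z v = matching_sum E (V - {v}) z / matching_sum E V z"

lemma neighbours_remove:
  assumes "\<forall>e\<in>E. card e = 2"
  shows "neighbours E (V - {v}) v = neighbours E V v"
  using assms by (auto simp: neighbours_def)

lemma matching_sum_ratio_recurrence:
  assumes "finite V" "v \<in> V" "\<forall>e\<in>E. card e = 2" "matching_sum E (V - {v}) z \<noteq> 0"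
  shows "matching_sum E V z = matching_sum E (V - {v}) z *
    (z - (\<Sum>u\<in>neighbours E V v. matching_ratio E (V - {v}) z u))"
  unfolding matching_sum_recurrence[OF assms(1-3)] matching_ratio_def
    sum_divide_distrib[symmetric]
  using assms(4) by (simp add: field_simps)

text \<open>By induction the ratios on \<open>V - {v}\<close> have negative imaginary part;
  subtracting them from \<open>z\<close> leaves a point \<open>w\<close> of the upper half plane, so
  \<open>w\<close> is nonzero and \<open>1 / w\<close> lies in the lower one. Nonvanishing and sign
  are proved together because the recurrence divides by the smaller matching sum.\<close>

lemma Heilmann_Lieb:
  fixes z :: complex
  assumes "finite V" and E: "\<forall>e\<in>E. card e = 2" and z: "Im z > 0"
  shows "matching_sum E V z \<noteq> 0 \<and> (\<forall>v\<in>V. Im (matching_ratio E V z v) < 0)"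
  using \<open>finite V\<close>
proof (induction V rule: finite_psubset_induct)
  case (psubset V)
  have *: "matching_sum E V z \<noteq> 0 \<and> Im (matching_ratio E V z v) < 0" if v: "v \<in> V" for v
  proof -
    have IH: "matching_sum E (V - {v}) z \<noteq> 0"
      "\<forall>u\<in>V - {v}. Im (matching_ratio E (V - {v}) z u) < 0"
      using psubset.IH[of "V - {v}"] v by auto
    define w where "w = z - (\<Sum>u\<in>neighbours E V v. matching_ratio E (V - {v}) z u)"
    have eq: "matching_sum E V z = matching_sum E (V - {v}) z * w"
      unfolding w_def by (rule matching_sum_ratio_recurrence) (use psubset v E IH in auto)
    have "(\<Sum>u\<in>neighbours E V v. Im (matching_ratio E (V - {v}) z u)) \<le> 0"
      by (rule sum_nonpos) (use IH(2) neighbours_remove[OF E, of V v] in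
          \<open>force simp: neighbours_def intro: less_imp_le\<close>)
    then have w: "Im w > 0"
      using z by (simp add: w_def)
    then have "w \<noteq> 0"
      by auto
    moreover have "matching_ratio E V z v = 1 / w"
      using IH(1) \<open>w \<noteq> 0\<close> by (simp add: matching_ratio_def eq)
    moreover have "Im (1 / w) < 0"
      using w \<open>w \<noteq> 0\<close> by (simp add: Im_divide')
    ultimately show ?thesis
      using eq IH(1) by simp
  qed
  then show ?case
    using E by (cases "V = {}") auto
qed

section \<open>Real-rootedness and logarithmic derivatives\<close>

lemma map_poly_of_real_mult:
  "map_poly of_real (p * q) = map_poly of_real p * (map_poly of_real q :: 'a::{real_algebra_1,comm_ring_1} poly)"
  by (rule poly_eqI) (simp add: coeff_map_poly coeff_mult)

lemma poly_map_poly_of_real: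
  "poly (map_poly of_real p) (of_real x) = (of_real (poly p x) :: 'a::{real_algebra_1,comm_ring_1})"
  by (induction p) (auto simp: map_poly_pCons)

text \<open>Roots are split off one at a time: the complex polynomial has a root, which is real by
  assumption, and the quotient inherits the assumption because its roots are roots of
  \<open>p\<close>.\<close>

lemma real_rooted_factorization:
  fixes p :: "real poly"
  assumes "p \<noteq> 0" and "\<And>z. poly (map_poly complex_of_real p) z = 0 \<Longrightarrow> z \<in> \<real>"
  shows "size (proots p) = degree p \<and> p = smult (lead_coeff p) (\<Prod>x\<in>#proots p. [:-x, 1:])"
  using assms
proof (induction "degree p" arbitrary: p)
  case 0
  then obtain c where "p = [:c:]"
    by (metis degree_eq_zeroE)
  then show ?case
    by simp
next
  case (Suc n)
  let ?q = "map_poly complex_of_real p"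
  have deg: "degree ?q = degree p"
    by (rule degree_map_poly) simp
  have "\<not> constant (poly ?q)"
    using Suc.hyps(2) deg by (auto simp: constant_degree)
  then obtain z where z: "poly ?q z = 0"
    using fundamental_theorem_of_algebra by blast
  with Suc.prems(2) obtain x where x: "z = of_real x"
    by (metis Reals_cases)
  have "poly p x = 0"
    using z by (simp add: x poly_map_poly_of_real)
  then obtain r where r: "p = [:-x, 1:] * r"
    by (metis dvdE poly_eq_0_iff_dvd)
  with Suc.prems(1) have "r \<noteq> 0"
    by auto
  have degp: "degree p = Suc (degree r)"
    unfolding r using \<open>r \<noteq> 0\<close> by (subst degree_mult_eq) auto
  have "poly (map_poly complex_of_real r) z = 0 \<Longrightarrow> z \<in> \<real>" for z
    by (rule Suc.prems(2)) (simp add: r map_poly_of_real_mult del: mult_pCons_left)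
  then have IH: "size (proots r) = degree r"
    "r = smult (lead_coeff r) (\<Prod>x\<in>#proots r. [:-x, 1:])"
    using Suc.hyps(1)[of r] Suc.hyps(2) degp \<open>r \<noteq> 0\<close> by auto
  have roots: "proots p = {#x#} + proots r"
    unfolding r using \<open>r \<noteq> 0\<close> by (subst proots_mult) auto
  have lead: "lead_coeff p = lead_coeff r"
    unfolding r by (simp add: lead_coeff_mult del: mult_pCons_left)
  have "p = [:-x, 1:] * smult (lead_coeff r) (\<Prod>x\<in>#proots r. [:-x, 1:])"
    using r IH(2) by metis
  also have "\<dots> = smult (lead_coeff p) (\<Prod>x\<in>#proots p. [:-x, 1:])"
    unfolding lead roots by (simp del: mult_pCons_left)
  finally show ?case
    using IH(1) degp roots by simp
qed

text \<open>\<open>Heilmann_Lieb\<close> excludes roots with positive imaginary part, and the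
  symmetry under negation excludes those with negative imaginary part.\<close>

lemma matching_poly_roots:
  assumes fin: "finite V" and E: "E \<subseteq> complete_edges V"
  shows "length (matching_roots V E) = card V"
    "matching_poly V E = (\<Prod>x\<leftarrow>matching_roots V E. [:-x, 1:])"
proof -
  note c2 = complete_edges_card[OF E]
  let ?p = "matching_poly V E"
  have "?p \<noteq> 0"
    using matching_poly_monic[OF assms] by auto
  moreover have "z \<in> \<real>" if "poly (map_poly complex_of_real ?p) z = 0" for z
  proof (rule ccontr)
    assume "z \<notin> \<real>"
    then have "Im z > 0 \<or> Im (- z) > 0"
      by (auto simp: complex_is_Real_iff)
    then have "matching_sum E V z \<noteq> 0"
      using Heilmann_Lieb[OF fin c2] matching_sum_uminus[OF fin c2, of z] by force
    with that show False
      by (simp add: poly_map_of_real_matching_poly[OF assms])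
  qed
  ultimately have *: "size (proots ?p) = degree ?p \<and>
      ?p = smult (lead_coeff ?p) (\<Prod>x\<in>#proots ?p. [:-x, 1:])"
    by (rule real_rooted_factorization)
  have mset: "mset (matching_roots V E) = proots ?p"
    by (simp add: matching_roots_def)
  show "length (matching_roots V E) = card V"
    using * matching_poly_monic[OF assms] mset by (metis size_mset)
  have "(\<Prod>x\<in>#proots ?p. [:-x, 1:]) = (\<Prod>x\<leftarrow>matching_roots V E. [:-x, 1:])"
    by (simp flip: mset prod_mset_prod_list mset_map)
  then show "?p = (\<Prod>x\<leftarrow>matching_roots V E. [:-x, 1:])"
    using * matching_poly_monic[OF assms] by simp
qed

lemma poly_prod_linear: "poly (\<Prod>x\<leftarrow>xs. [:-x, 1:]) z = (\<Prod>x\<leftarrow>xs. z - x)"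
  for z :: "'a::comm_ring_1"
  by (induction xs) (simp_all add: algebra_simps)

text \<open>The logarithmic derivative of a product of linear factors, multiplied out; induction
  with the product rule.\<close>

lemma pderiv_prod_linear:
  fixes z :: "'a::{field_char_0}"
  assumes "z \<notin> set xs"
  shows "poly (pderiv (\<Prod>x\<leftarrow>xs. [:-x, 1:])) z
    = poly (\<Prod>x\<leftarrow>xs. [:-x, 1:]) z * (\<Sum>x\<leftarrow>xs. 1 / (z - x))"
  using assms
proof (induction xs)
  case (Cons x xs)
  then show ?case
    by (simp add: pderiv_mult pderiv_pCons del: mult_pCons_left) (simp add: field_simps)
qed auto

text \<open>The logarithmic derivative is computed twice, from the linear factors and from
  \<open>matching_sum_deriv\<close>. This ties the roots to ratios that the vertex recurrence
  controls.\<close>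

lemma matching_roots_stieltjes:
  assumes fin: "finite V" and E: "E \<subseteq> complete_edges V" and z: "matching_sum E V z \<noteq> 0"
  shows "(\<Sum>x\<leftarrow>matching_roots V E. 1 / (z - x)) = (\<Sum>v\<in>V. matching_ratio E V z v)"
proof -
  let ?p = "matching_poly V E"
  have "poly ?p = matching_sum E V"
    using poly_matching_poly[OF fin E] by (simp add: fun_eq_iff)
  then have "(poly ?p has_field_derivative (\<Sum>v\<in>V. matching_sum E (V - {v}) z)) (at z)"
    using matching_sum_deriv[OF fin, of E z] by simp
  then have d: "poly (pderiv ?p) z = (\<Sum>v\<in>V. matching_sum E (V - {v}) z)"
    using poly_DERIV DERIV_unique by blast
  have "poly ?p z \<noteq> 0"
    using z poly_matching_poly[OF fin E] by simp
  then have "z \<notin> set (matching_roots V E)"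
    unfolding matching_poly_roots(2)[OF fin E] by (auto simp: poly_prod_linear prod_list_zero_iff)
  then have "poly (pderiv ?p) z = poly ?p z * (\<Sum>x\<leftarrow>matching_roots V E. 1 / (z - x))"
    unfolding matching_poly_roots(2)[OF fin E] by (rule pderiv_prod_linear)
  with d show ?thesis
    using z unfolding matching_ratio_def sum_divide_distrib[symmetric] poly_matching_poly[OF fin E]
    by (simp add: field_simps)
qed

section \<open>Ratios on the real axis\<close>

text \<open>At most \<open>\<Delta>\<close> ratios of size at most \<open>2 / z\<close> add up to at
  most \<open>2 * \<Delta> / z \<le> z / 2\<close>, so the denominator in the recurrence stays at
  least \<open>z / 2\<close> and the bound reproduces itself. Deleting vertices only lowers
  degrees.\<close>

lemma matching_ratio_bounds:
  fixes z \<Delta> :: real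
  assumes "finite V" and E: "\<forall>e\<in>E. card e = 2" and z: "z > 0"
    and deg: "\<forall>v\<in>V. real (card (neighbours E V v)) \<le> \<Delta>" and \<Delta>: "4 * \<Delta> \<le> z\<^sup>2"
  shows "matching_sum E V z > 0 \<and> (\<forall>v\<in>V. 0 < matching_ratio E V z v \<and> matching_ratio E V z v \<le> 2 / z)"
  using \<open>finite V\<close> deg
proof (induction V rule: finite_psubset_induct)
  case (psubset V)
  have *: "matching_sum E V z > 0 \<and> 0 < matching_ratio E V z v \<and> matching_ratio E V z v \<le> 2 / z"
    if v: "v \<in> V" for v
  proof -
    have "real (card (neighbours E (V - {v}) u)) \<le> \<Delta>" if "u \<in> V - {v}" for u
      by (rule order.trans[OF of_nat_mono[OF card_mono] psubset.prems[rule_format, of u]])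
         (use that psubset.hyps in \<open>auto simp: neighbours_def\<close>)
    then have IH: "matching_sum E (V - {v}) z > 0"
      "\<forall>u\<in>V - {v}. 0 < matching_ratio E (V - {v}) z u \<and> matching_ratio E (V - {v}) z u \<le> 2 / z"
      using psubset.IH[of "V - {v}"] v by auto
    define w where "w = z - (\<Sum>u\<in>neighbours E V v. matching_ratio E (V - {v}) z u)"
    have eq: "matching_sum E V z = matching_sum E (V - {v}) z * w"
      unfolding w_def by (rule matching_sum_ratio_recurrence) (use psubset v E IH in auto)
    have "(\<Sum>u\<in>neighbours E V v. matching_ratio E (V - {v}) z u) \<le> real (card (neighbours E V v)) * (2 / z)"
      by (rule sum_bounded_above) (use IH(2) neighbours_remove[OF E, of V v] in
          \<open>auto simp: neighbours_def\<close>)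
    also have "\<dots> \<le> \<Delta> * (2 / z)"
      using psubset.prems v z by (intro mult_right_mono) auto
    also have "\<dots> \<le> z / 2"
      using \<Delta> z by (simp add: field_simps power2_eq_square)
    finally have w: "w \<ge> z / 2"
      by (simp add: w_def)
    then have "w > 0"
      using z by simp
    moreover have "matching_ratio E V z v = 1 / w"
      using IH(1) \<open>w > 0\<close> by (simp add: matching_ratio_def eq)
    moreover have "1 / w \<le> 2 / z"
      using w z \<open>w > 0\<close> by (simp add: field_simps)
    ultimately show ?thesis
      using eq IH(1) by simp
  qed
  then show ?case
    using E by (cases "V = {}") auto
qed

text \<open>The recurrence is unrolled \<open>k\<close> more times inside the fixed graph on
  \<open>W\<close>. The budget \<open>card (W - V) + k \<le> K\<close> limits the deleted vertices,
  so degrees in \<open>V\<close> differ from those in \<open>W\<close> by at most \<open>K\<close>.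
  One unrolling multiplies the error by at most \<open>q\<close>, and the deviation of the degree
  from \<open>d\<close> adds at most \<open>\<epsilon>\<close>, both in units of
  \<open>2 / z\<close>.\<close>

lemma matching_ratio_approx:
  fixes z \<Delta> \<delta> d \<sigma> :: real
  assumes fin: "finite W" and E: "\<forall>e\<in>E. card e = 2" and z: "z > 0"
    and deg: "\<forall>v\<in>W. real (card (neighbours E W v)) \<le> \<Delta>" and \<Delta>: "4 * \<Delta> < z\<^sup>2" "0 \<le> \<Delta>"
    and dev: "\<forall>v\<in>W. \<bar>real (card (neighbours E W v)) - d\<bar> \<le> \<delta>" and "0 \<le> \<delta>"
    and \<sigma>: "0 < \<sigma>" "\<sigma> \<le> 2 / z" "\<sigma> * (z - d * \<sigma>) = 1"
    and "V \<subseteq> W" "v \<in> V" "card (W - V) + k \<le> K"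
  defines "q \<equiv> 4 * \<Delta> / z\<^sup>2" and "\<epsilon> \<equiv> 4 * (\<delta> + real K) / z\<^sup>2"
  shows "\<bar>matching_ratio E V z v - \<sigma>\<bar> \<le> 2 / z * (q ^ k + \<epsilon> / (1 - q))"
proof -
  have q: "0 \<le> q" "q < 1"
    using \<Delta> z by (auto simp: q_def field_simps)
  have \<epsilon>: "0 \<le> \<epsilon>"
    using \<open>0 \<le> \<delta>\<close> by (simp add: \<epsilon>_def)
  have mono: "card (neighbours E U v) \<le> card (neighbours E W v)" if "U \<subseteq> W" for U v
    by (rule card_mono) (use fin that in \<open>auto simp: neighbours_def\<close>)
  have bounds: "matching_sum E U z > 0" "\<And>v. v \<in> U \<Longrightarrow> 0 < matching_ratio E U z v"
      "\<And>v. v \<in> U \<Longrightarrow> matching_ratio E U z v \<le> 2 / z" if "U \<subseteq> W" for U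
  proof -
    have "matching_sum E U z > 0 \<and> (\<forall>v\<in>U. 0 < matching_ratio E U z v \<and> matching_ratio E U z v \<le> 2 / z)"
    proof (rule matching_ratio_bounds[where \<Delta> = \<Delta>])
      show "\<forall>v\<in>U. real (card (neighbours E U v)) \<le> \<Delta>"
        using deg mono[OF that] that by (meson of_nat_mono order_trans subsetD)
    qed (use fin that E z \<Delta> in \<open>auto intro: finite_subset\<close>)
    then show "matching_sum E U z > 0" "\<And>v. v \<in> U \<Longrightarrow> 0 < matching_ratio E U z v"
      "\<And>v. v \<in> U \<Longrightarrow> matching_ratio E U z v \<le> 2 / z"
      by auto
  qed
  show ?thesis
    using \<open>V \<subseteq> W\<close> \<open>v \<in> V\<close> \<open>card (W - V) + k \<le> K\<close>
  proof (induction k arbitrary: V v)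
    case 0
    \<comment> \<open>With no unrolling left only the trivial bound remains: both numbers are
      positive and at most \<open>2 / z\<close>.\<close>
    have "\<bar>matching_ratio E V z v - \<sigma>\<bar> \<le> 2 / z"
      using bounds(2,3)[of V v] 0 \<sigma> by linarith
    also have "\<dots> \<le> 2 / z * (q ^ 0 + \<epsilon> / (1 - q))"
      using q \<epsilon> z by (simp add: field_simps)
    finally show ?case .
  next
    case (Suc k)
    let ?N = "neighbours E V v" and ?R = "matching_ratio E (V - {v}) z"
    let ?B = "2 / z * (q ^ k + \<epsilon> / (1 - q))"
    have finV: "finite V"
      using Suc.prems fin finite_subset by blast
    have N: "?N \<subseteq> V - {v}"
      using neighbours_remove[OF E, of V v] by (auto simp: neighbours_def)
    have "W - (V - {v}) = insert v (W - V)"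
      using Suc.prems by auto
    then have card': "card (W - (V - {v})) + k \<le> K"
      using Suc.prems fin by simp
    have IH: "\<bar>?R u - \<sigma>\<bar> \<le> ?B" if "u \<in> ?N" for u
      using Suc.IH[of "V - {v}" u] Suc.prems card' that N by blast
    \<comment> \<open>The vertices deleted so far cost \<open>v\<close> at most
      \<open>card (W - V)\<close> neighbours.\<close>
    have "card (neighbours E W v) \<le> card (?N \<union> (W - V))"
      by (rule card_mono) (use fin finV in \<open>auto simp: neighbours_def\<close>)
    also have "\<dots> \<le> card ?N + card (W - V)"
      by (rule card_Un_le)
    finally have "card (neighbours E W v) \<le> card ?N + K"
      using Suc.prems by simp
    then have degN: "\<bar>real (card ?N) - d\<bar> \<le> \<delta> + real K" "real (card ?N) \<le> \<Delta>"
      using dev[rule_format, of v] deg[rule_format, of v] mono[OF Suc.prems(1), of v] Suc.prems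
      by auto
    define w where "w = z - (\<Sum>u\<in>?N. ?R u)"
    have pos: "matching_sum E (V - {v}) z > 0" "matching_sum E V z > 0"
      using bounds(1)[of V] bounds(1)[of "V - {v}"] Suc.prems by auto
    have eq: "matching_sum E V z = matching_sum E (V - {v}) z * w"
      unfolding w_def by (rule matching_sum_ratio_recurrence) (use Suc.prems finV E pos in auto)
    then have Rw: "matching_ratio E V z v * w = 1"
      using pos by (auto simp: matching_ratio_def)
    have R: "0 < matching_ratio E V z v" "matching_ratio E V z v \<le> 2 / z"
      using bounds(2,3)[of V v] Suc.prems by auto
    \<comment> \<open>Each of the two terms is multiplied by the equation that the other one
      satisfies; the contributions of \<open>z\<close> then cancel.\<close>
    have "matching_ratio E V z v - \<sigma>
        = matching_ratio E V z v * (\<sigma> * (z - d * \<sigma>)) - \<sigma> * (matching_ratio E V z v * w)"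
      by (simp only: \<sigma>(3) Rw mult_1_right)
    also have "\<dots> = (matching_ratio E V z v * \<sigma>) * ((\<Sum>u\<in>?N. ?R u) - d * \<sigma>)"
      by (simp add: w_def algebra_simps)
    also have "(\<Sum>u\<in>?N. ?R u) - d * \<sigma> = (\<Sum>u\<in>?N. ?R u - \<sigma>) + (real (card ?N) - d) * \<sigma>"
      by (simp add: sum_subtractf algebra_simps)
    finally have "\<bar>matching_ratio E V z v - \<sigma>\<bar>
        = (matching_ratio E V z v * \<sigma>) * \<bar>(\<Sum>u\<in>?N. ?R u - \<sigma>) + (real (card ?N) - d) * \<sigma>\<bar>"
      using R \<sigma> by (simp add: abs_mult)
    also have "\<dots> \<le> (2 / z * (2 / z)) * (\<Delta> * ?B + (\<delta> + real K) * (2 / z))"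
    proof (rule mult_mono)
      have "\<bar>\<Sum>u\<in>?N. ?R u - \<sigma>\<bar> \<le> (\<Sum>u\<in>?N. \<bar>?R u - \<sigma>\<bar>)"
        by (rule sum_abs)
      also have "\<dots> \<le> real (card ?N) * ?B"
        by (rule sum_bounded_above) (rule IH)
      also have "\<dots> \<le> \<Delta> * ?B"
        using degN q \<epsilon> z by (intro mult_right_mono) auto
      finally have 1: "\<bar>\<Sum>u\<in>?N. ?R u - \<sigma>\<bar> \<le> \<Delta> * ?B" .
      have "\<bar>(real (card ?N) - d) * \<sigma>\<bar> \<le> (\<delta> + real K) * (2 / z)"
        unfolding abs_mult by (rule mult_mono) (use degN \<sigma> \<open>0 \<le> \<delta>\<close> in auto)
      with 1 show "\<bar>(\<Sum>u\<in>?N. ?R u - \<sigma>) + (real (card ?N) - d) * \<sigma>\<bar> \<le> \<Delta> * ?B + (\<delta> + real K) * (2 / z)"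
        by linarith
    next
      show "matching_ratio E V z v * \<sigma> \<le> 2 / z * (2 / z)"
        by (rule mult_mono) (use R \<sigma> z in auto)
    qed (use z in auto)
    also have "\<dots> = 2 / z * (q * (q ^ k + \<epsilon> / (1 - q)) + \<epsilon>)"
      using z by (simp add: q_def \<epsilon>_def field_simps power2_eq_square)
    \<comment> \<open>The number \<open>\<epsilon> / (1 - q)\<close> is the fixed point of the error
      recursion \<open>B \<mapsto> q * B + \<epsilon>\<close>.\<close>
    also have "q * (q ^ k + \<epsilon> / (1 - q)) + \<epsilon> = q ^ Suc k + \<epsilon> / (1 - q)"
      using q by (simp add: field_simps)
    finally show ?case .
  qed
qed

section \<open>Stieltjes transforms and weak convergence\<close>

lemma integrable_interval_distribution:
  fixes f :: "real \<Rightarrow> real"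
  assumes "real_distribution M" and ae: "AE x in M. x \<in> {-c..c}"
    and f: "f \<in> borel_measurable borel" "continuous_on {-c..c} f"
  shows "integrable M f"
proof -
  interpret real_distribution M by fact
  have "bounded (f ` {-c..c})"
    using f by (intro compact_imp_bounded compact_continuous_image) auto
  then obtain B where "\<forall>x\<in>{-c..c}. norm (f x) \<le> B"
    by (auto simp: bounded_iff)
  then have "AE x in M. norm (f x) \<le> B"
    by (intro eventually_mono[OF ae]) simp
  then show ?thesis
    by (rule integrable_const_bound) (use f in simp)
qed

lemma integral_interval_distribution_close:
  fixes f g :: "real \<Rightarrow> real"
  assumes "real_distribution M" and ae: "AE x in M. x \<in> {-c..c}"
    and f: "f \<in> borel_measurable borel" "continuous_on {-c..c} f"
    and g: "g \<in> borel_measurable borel" "continuous_on {-c..c} g"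
    and e: "\<And>x. x \<in> {-c..c} \<Longrightarrow> \<bar>f x - g x\<bar> \<le> e"
  shows "\<bar>integral\<^sup>L M f - integral\<^sup>L M g\<bar> \<le> e"
proof -
  interpret real_distribution M by fact
  note [simp] = integrable_interval_distribution[OF assms(1,2) f]
    integrable_interval_distribution[OF assms(1,2) g]
  have "\<bar>integral\<^sup>L M f - integral\<^sup>L M g\<bar> = \<bar>\<integral>x. f x - g x \<partial>M\<bar>"
    by simp
  also have "\<dots> \<le> (\<integral>x. \<bar>f x - g x\<bar> \<partial>M)"
    by (rule integral_abs_bound)
  also have "\<dots> \<le> (\<integral>x. e \<partial>M)"
    by (rule integral_mono_AE[OF _ _ eventually_mono[OF ae]]) (use e in simp_all)
  also have "\<dots> = e"
    using prob_space by simp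
  finally show ?thesis .
qed

locale interval_distributions =
  fixes \<mu> :: "nat \<Rightarrow> real measure" and \<nu> :: "real measure" and c :: real
  assumes distr: "\<And>n. real_distribution (\<mu> n)" "real_distribution \<nu>"
    and support: "\<And>n. AE x in \<mu> n. x \<in> {-c..c}" "AE x in \<nu>. x \<in> {-c..c}"
begin

text \<open>Continuity is asked only on the interval carrying all the measures, so that
  \<open>1 / (t - x)\<close> with \<open>t > c\<close> qualifies despite its pole.\<close>

definition admissible :: "(real \<Rightarrow> real) \<Rightarrow> bool" where
  "admissible f \<longleftrightarrow> f \<in> borel_measurable borel \<and> continuous_on {-c..c} f"

definition conv :: "(real \<Rightarrow> real) \<Rightarrow> bool" where
  "conv f \<longleftrightarrow> admissible f \<and> (\<lambda>n. integral\<^sup>L (\<mu> n) f) \<longlonglongrightarrow> integral\<^sup>L \<nu> f"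

lemma admissible_integrable:
  assumes "admissible f"
  shows "integrable (\<mu> n) f" "integrable \<nu> f"
proof -
  have f: "f \<in> borel_measurable borel" "continuous_on {-c..c} f"
    using assms by (simp_all add: admissible_def)
  show "integrable (\<mu> n) f"
    by (rule integrable_interval_distribution[OF distr(1) support(1) f])
  show "integrable \<nu> f"
    by (rule integrable_interval_distribution[OF distr(2) support(2) f])
qed

text \<open>Integrating against a probability measure on the interval does not increase a uniform
  error, so one approximant serves all \<open>\<mu> n\<close> and \<open>\<nu>\<close> at
  once.\<close>

lemma conv_limit:
  assumes f: "admissible f"
    and g: "\<And>e. e > 0 \<Longrightarrow> \<exists>g. conv g \<and> (\<forall>x\<in>{-c..c}. \<bar>f x - g x\<bar> \<le> e)"
  shows "conv f"
proof -
  have "(\<lambda>n. integral\<^sup>L (\<mu> n) f) \<longlonglongrightarrow> integral\<^sup>L \<nu> f"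
  proof (rule tendstoI)
    fix e :: real assume "e > 0"
    then obtain g where g: "conv g" "\<forall>x\<in>{-c..c}. \<bar>f x - g x\<bar> \<le> e / 3"
      using assms(2)[of "e / 3"] by auto
    have close: "\<bar>integral\<^sup>L M f - integral\<^sup>L M g\<bar> \<le> e / 3"
      if "real_distribution M" "AE x in M. x \<in> {-c..c}" for M
      by (rule integral_interval_distribution_close[OF that])
         (use f g in \<open>auto simp: conv_def admissible_def\<close>)
    have "eventually (\<lambda>n. dist (integral\<^sup>L (\<mu> n) g) (integral\<^sup>L \<nu> g) < e / 3) sequentially"
      using g(1) \<open>e > 0\<close> unfolding conv_def by (intro tendstoD) auto
    then show "eventually (\<lambda>n. dist (integral\<^sup>L (\<mu> n) f) (integral\<^sup>L \<nu> f) < e) sequentially"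
    proof eventually_elim
      case (elim n)
      then show ?case
        using close[OF distr(1) support(1), of n] close[OF distr(2) support(2)]
        unfolding dist_real_def by linarith
    qed
  qed
  with f show ?thesis
    by (simp add: conv_def)
qed

lemma conv_cmult:
  assumes "conv f"
  shows "conv (\<lambda>x. a * f x)"
proof -
  have [measurable]: "f \<in> borel_measurable borel" and "continuous_on {-c..c} f"
    and "(\<lambda>n. integral\<^sup>L (\<mu> n) f) \<longlonglongrightarrow> integral\<^sup>L \<nu> f"
    using assms by (simp_all add: conv_def admissible_def)
  then show ?thesis
    unfolding conv_def admissible_def integral_mult_right_zero
    by (intro conjI tendsto_mult_left continuous_on_mult_left) measurable
qed

lemma conv_add:
  assumes "conv f" "conv g"
  shows "conv (\<lambda>x. f x + g x)"
proof -
  have [measurable]: "f \<in> borel_measurable borel" "g \<in> borel_measurable borel"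
    and "continuous_on {-c..c} f" "continuous_on {-c..c} g"
    and lim: "(\<lambda>n. integral\<^sup>L (\<mu> n) f) \<longlonglongrightarrow> integral\<^sup>L \<nu> f"
      "(\<lambda>n. integral\<^sup>L (\<mu> n) g) \<longlonglongrightarrow> integral\<^sup>L \<nu> g"
    using assms by (simp_all add: conv_def admissible_def)
  then have "admissible (\<lambda>x. f x + g x)"
    unfolding admissible_def by (intro conjI continuous_on_add) measurable
  moreover have "integral\<^sup>L (\<mu> n) (\<lambda>x. f x + g x) = integral\<^sup>L (\<mu> n) f + integral\<^sup>L (\<mu> n) g" for n
    using assms by (intro Bochner_Integration.integral_add admissible_integrable) (simp_all add: conv_def)
  moreover have "integral\<^sup>L \<nu> (\<lambda>x. f x + g x) = integral\<^sup>L \<nu> f + integral\<^sup>L \<nu> g"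
    using assms by (intro Bochner_Integration.integral_add admissible_integrable) (simp_all add: conv_def)
  ultimately show ?thesis
    unfolding conv_def by (simp add: tendsto_add[OF lim])
qed

lemma conv_sum: "(\<And>i. i \<in> I \<Longrightarrow> conv (f i)) \<Longrightarrow> conv (\<lambda>x. \<Sum>i\<in>I. f i x)"
proof (induction I rule: infinite_finite_induct)
  case (insert i I)
  then show ?case
    using conv_add[of "f i" "\<lambda>x. \<Sum>i\<in>I. f i x"] by simp
qed (simp_all add: conv_def admissible_def)

text \<open>The moments are recovered from the Stieltjes transform near infinity, because
  \<open>t x\<^sup>k / (t - x)\<close> tends to \<open>x\<^sup>k\<close> uniformly on the interval as \<open>t\<close> grows.\<close>

lemma conv_power:
  assumes c: "c \<ge> 0" "c < b" and st: "\<And>t. t \<ge> b \<Longrightarrow> conv (\<lambda>x. 1 / (t - x))"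
  shows "conv (\<lambda>x. x ^ k)"
proof -
  have step: "conv (\<lambda>x. x ^ k)" if *: "\<And>t. t \<ge> b \<Longrightarrow> conv (\<lambda>x. x ^ k / (t - x))" for k
  proof (rule conv_limit)
    show "admissible (\<lambda>x. x ^ k)"
      unfolding admissible_def by (intro conjI continuous_intros) simp
    fix e :: real assume "e > 0"
    \<comment> \<open>The error is at most \<open>c ^ Suc k / (t - c)\<close>, and this
      \<open>t\<close> brings it down to \<open>e\<close>.\<close>
    define t where "t = max b (c + c ^ Suc k / e)"
    have t: "t \<ge> b" "t > c" "c ^ Suc k / e \<le> t - c"
      using c by (auto simp: t_def)
    have "\<bar>x ^ k - t * (x ^ k / (t - x))\<bar> \<le> e" if x: "x \<in> {-c..c}" for x
    proof -
      have "x ^ k - t * (x ^ k / (t - x)) = - (x ^ Suc k / (t - x))"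
        using x t by (simp add: field_simps)
      then have "\<bar>x ^ k - t * (x ^ k / (t - x))\<bar> = \<bar>x\<bar> ^ Suc k / (t - x)"
        using x t by (simp add: abs_mult power_abs)
      also have "\<dots> \<le> c ^ Suc k / (t - c)"
        using x t c by (intro frac_le power_mono) auto
      also have "\<dots> \<le> e"
        using t \<open>e > 0\<close> by (simp add: field_simps)
      finally show ?thesis .
    qed
    then show "\<exists>g. conv g \<and> (\<forall>x\<in>{-c..c}. \<bar>x ^ k - g x\<bar> \<le> e)"
      using conv_cmult[OF *[OF t(1)], of t] by blast
  qed
  have "\<forall>t\<ge>b. conv (\<lambda>x. x ^ k / (t - x))"
  proof (induction k)
    case 0
    then show ?case
      using st by simp
  next
    case (Suc k)
    show ?case
    proof (intro allI impI)
      fix t assume t: "t \<ge> b"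
      have "conv (\<lambda>x. t * (x ^ k / (t - x)) + (-1) * x ^ k)"
        using Suc t step[of k] by (intro conv_add conv_cmult) auto
      \<comment> \<open>The identity may fail at the pole \<open>x = t\<close>, so the two functions
        are only compared on the interval, where \<open>conv_limit\<close> applies with error
        0.\<close>
      moreover have "\<forall>x\<in>{-c..c}. \<bar>x ^ Suc k / (t - x) - (t * (x ^ k / (t - x)) + (-1) * x ^ k)\<bar> \<le> 0"
        using t c by (auto simp: field_simps)
      moreover have "admissible (\<lambda>x. x ^ Suc k / (t - x))"
        unfolding admissible_def using t c by (intro conjI continuous_intros) auto
      ultimately show "conv (\<lambda>x. x ^ Suc k / (t - x))"
        by (intro conv_limit) (auto intro: order.trans)
    qed
  qed
  then show ?thesis
    by (intro step) auto
qed

text \<open>Stieltjes transforms to the right of the interval give the moments, hence all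
  polynomials, and Weierstrass approximation on the interval reaches every continuous
  function.\<close>

lemma stieltjes_conv_imp_integral_conv:
  assumes c: "c \<ge> 0" "c < b"
    and st: "\<And>t. t \<ge> b \<Longrightarrow> (\<lambda>n. \<integral>x. 1 / (t - x) \<partial>\<mu> n) \<longlonglongrightarrow> (\<integral>x. 1 / (t - x) \<partial>\<nu>)"
    and f: "continuous_on UNIV (f :: real \<Rightarrow> real)"
  shows "(\<lambda>n. integral\<^sup>L (\<mu> n) f) \<longlonglongrightarrow> integral\<^sup>L \<nu> f"
proof -
  have pow: "conv (\<lambda>x. x ^ k)" for k
  proof (rule conv_power[OF c])
    show "conv (\<lambda>x. 1 / (t - x))" if "t \<ge> b" for t
      unfolding conv_def admissible_def
      using st[OF that] that c by (intro conjI continuous_intros) auto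
  qed
  have "conv f"
  proof (rule conv_limit)
    have cont: "continuous_on {-c..c} f"
      using f continuous_on_subset by blast
    then show "admissible f"
      using f by (auto simp: admissible_def intro: borel_measurable_continuous_onI)
    fix e :: real assume "e > 0"
    then obtain g where g: "real_polynomial_function g" "\<And>x. x \<in> {-c..c} \<Longrightarrow> \<bar>f x - g x\<bar> < e"
      using Stone_Weierstrass_real_polynomial_function[OF compact_Icc cont] by blast
    from g(1) obtain a n where "g = (\<lambda>x. \<Sum>i\<le>n. a i * x ^ i)"
      unfolding real_polynomial_function_iff_sum by blast
    then have "conv g"
      using pow by (auto intro!: conv_sum conv_cmult)
    moreover have "\<forall>x\<in>{-c..c}. \<bar>f x - g x\<bar> \<le> e"
      using g(2) by (simp add: less_imp_le)
    ultimately show "\<exists>g. conv g \<and> (\<forall>x\<in>{-c..c}. \<bar>f x - g x\<bar> \<le> e)"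
      by blast
  qed
  then show ?thesis
    by (simp add: conv_def)
qed

end

section \<open>The semicircle distribution\<close>

lemma semicircle_density_nonneg: "semicircle_density x \<ge> 0"
  by (auto simp: semicircle_density_def abs_le_square_iff[of x 2, simplified])

lemma semicircle_density_measurable [measurable]: "semicircle_density \<in> borel_measurable borel"
  unfolding semicircle_density_def[abs_def] by measurable

text \<open>For a nonnegative integrand the gauge integral is a Lebesgue integral, so
  antiderivatives can be used to integrate against the semicircle law.\<close>

lemma has_bochner_integral_semicircle:
  fixes f :: "real \<Rightarrow> real"
  assumes [measurable]: "f \<in> borel_measurable borel" and nonneg: "\<And>x. x \<in> {-2..2} \<Longrightarrow> f x \<ge> 0"
    and int: "((\<lambda>x. sqrt (4 - x\<^sup>2) * f x) has_integral I) {-2..2}"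
  shows "has_bochner_integral semicircle_measure f (I / (2 * pi))"
proof -
  have supp: "semicircle_density x = 0" if "x \<notin> {-2..2}" for x
    using that by (auto simp: semicircle_density_def)
  have "((\<lambda>x. 1 / (2 * pi) * (sqrt (4 - x\<^sup>2) * f x)) has_integral 1 / (2 * pi) * I) {-2..2}"
    by (rule has_integral_mult_right[OF int])
  then have "((\<lambda>x. semicircle_density x * f x) has_integral I / (2 * pi)) {-2..2}"
    by (subst has_integral_cong[where g = "\<lambda>x. 1 / (2 * pi) * (sqrt (4 - x\<^sup>2) * f x)"])
       (auto simp: semicircle_density_def)
  then have hi: "((\<lambda>x. semicircle_density x * f x) has_integral I / (2 * pi)) UNIV"
    by (rule has_integral_on_superset) (use supp in auto)
  have nn: "semicircle_density x * f x \<ge> 0" for x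
    using supp nonneg semicircle_density_nonneg by (cases "x \<in> {-2..2}") auto
  have "has_bochner_integral lborel (\<lambda>x. semicircle_density x * f x) (I / (2 * pi))"
    using nn_integral_has_integral_lborel[OF _ nn hi] has_integral_nonneg[OF hi] nn
    by (intro has_bochner_integral_nn_integral) auto
  then show ?thesis
    unfolding semicircle_measure_def
    by (intro has_bochner_integral_density) (auto simp: semicircle_density_nonneg)
qed

lemma semicircle_total: "((\<lambda>x. sqrt (4 - x\<^sup>2)) has_integral (2 * pi)) {-2..2::real}"
proof -
  let ?F = "\<lambda>x::real. x * sqrt (4 - x\<^sup>2) / 2 + 2 * arcsin (x / 2)"
  have "((\<lambda>x. sqrt (4 - x\<^sup>2)) has_integral (?F 2 - ?F (-2))) {-2..2}"
  \<comment> \<open>The derivative rules for \<open>sqrt\<close> and \<open>arcsin\<close> fail at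
    the endpoints, so differentiability is used in the interior only, with continuity up to the
    boundary.\<close>
  proof (rule fundamental_theorem_of_calculus_interior)
    show "continuous_on {-2..2} ?F"
      by (intro continuous_intros) auto
    fix x :: real assume x: "x \<in> {-2<..<2}"
    then have "x\<^sup>2 < 4"
      using abs_square_less_1[of "x / 2"] by (auto simp: power_divide)
    then have r: "sqrt (4 - x\<^sup>2) > 0" "(sqrt (4 - x\<^sup>2))\<^sup>2 = 4 - x\<^sup>2"
      by auto
    have "sqrt (1 - (x / 2)\<^sup>2) = sqrt ((4 - x\<^sup>2) / 4)"
      by (simp add: field_simps)
    then have r2: "sqrt (1 - (x / 2)\<^sup>2) = sqrt (4 - x\<^sup>2) / 2"
      by (simp add: real_sqrt_divide)
    have "(?F has_real_derivative sqrt (4 - x\<^sup>2)) (at x)"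
      using x \<open>x\<^sup>2 < 4\<close> r
      by (auto intro!: derivative_eq_intros simp: r2)
         (simp add: field_simps power2_eq_square)
    then show "(?F has_vector_derivative sqrt (4 - x\<^sup>2)) (at x)"
      by (simp add: has_real_derivative_iff_has_vector_derivative)
  qed auto
  then show ?thesis
    by (simp add: arcsin_minus)
qed

text \<open>With \<open>r = sqrt (4 - x\<^sup>2)\<close> and \<open>s = sqrt (t\<^sup>2 - 4)\<close>
  one has \<open>r / (t - x) = t / r + x / r - s\<^sup>2 / (r * (t - x))\<close>, and the three
  terms are the derivatives of the three parts of \<open>?F\<close>. From -2 to 2 each arcsine grows
  by \<open>pi\<close>, and the square root of \<open>4 - x\<^sup>2\<close> vanishes at both
  ends.\<close>

lemma semicircle_stieltjes_integral:
  fixes t :: real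
  assumes t: "t > 2"
  shows "((\<lambda>x. sqrt (4 - x\<^sup>2) * (1 / (t - x))) has_integral (pi * (t - sqrt (t\<^sup>2 - 4)))) {-2..2}"
proof -
  \<comment> \<open>The Moebius map with pole \<open>t\<close> that sends -2 to -1 and 2 to
    1.\<close>
  let ?u = "\<lambda>x. (t * x - 4) / (2 * (t - x))"
  let ?F = "\<lambda>x. t * arcsin (x / 2) - sqrt (4 - x\<^sup>2) - sqrt (t\<^sup>2 - 4) * arcsin (?u x)"
  have "t * t > 2 * 2"
    using t by (intro mult_strict_mono) auto
  then have t4: "t\<^sup>2 - 4 > 0"
    by (simp add: power2_eq_square)
  have u: "1 - (?u x)\<^sup>2 = (t\<^sup>2 - 4) * (4 - x\<^sup>2) / (2 * (t - x))\<^sup>2" if "x < t" for x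
    using that by (simp add: power_divide divide_simps) (simp add: power2_eq_square algebra_simps)
  have u_le: "-1 \<le> ?u x \<and> ?u x \<le> 1" if "x \<in> {-2..2}" for x
  proof -
    \<comment> \<open>Cleared of the positive denominator, the upper and the lower bound on
      \<open>?u x\<close> are these two inequalities.\<close>
    have "(t + 2) * (x - 2) \<le> 0" "(t - 2) * (x + 2) \<ge> 0"
      using that t by (auto simp: mult_nonneg_nonpos)
    then show ?thesis
      using that t by (auto simp: field_simps)
  qed
  have "((\<lambda>x. sqrt (4 - x\<^sup>2) * (1 / (t - x))) has_integral (?F 2 - ?F (-2))) {-2..2}"
  proof (rule fundamental_theorem_of_calculus_interior)
    show "continuous_on {-2..2} ?F"
      using u_le t by (intro continuous_intros) auto
    fix x :: real assume x: "x \<in> {-2<..<2}"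
    then have x4: "x\<^sup>2 < 4"
      using abs_square_less_1[of "x / 2"] by (auto simp: power_divide)
    define r where "r = sqrt (4 - x\<^sup>2)"
    define s where "s = sqrt (t\<^sup>2 - 4)"
    have r: "r > 0" "r\<^sup>2 = 4 - x\<^sup>2" and s: "s > 0" "s\<^sup>2 = t\<^sup>2 - 4"
      using x4 t4 by (auto simp: r_def s_def)
    have "sqrt (1 - (x / 2)\<^sup>2) = sqrt ((4 - x\<^sup>2) / 4)"
      by (simp add: field_simps)
    then have r2: "sqrt (1 - (x / 2)\<^sup>2) = r / 2"
      by (simp add: real_sqrt_divide r_def)
    have xt: "x < t"
      using x t by simp
    have u2: "sqrt (1 - (?u x)\<^sup>2) = s * r / (2 * (t - x))"
      unfolding u[OF xt] using xt by (simp add: real_sqrt_divide real_sqrt_mult r_def s_def)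
    have "1 - (?u x)\<^sup>2 > 0"
      unfolding u[OF xt] using xt x4 t4 by simp
    then have "\<bar>?u x\<bar> < 1"
      by (metis abs_square_less_1 diff_gt_0_iff_gt)
    then have ux: "-1 < ?u x" "?u x < 1"
      unfolding abs_less_iff by linarith+
    have num: "t * (2 * (t - x)) - (t * x - 4) * (- 2) = 2 * s\<^sup>2"
      unfolding s(2) by (simp add: algebra_simps power2_eq_square)
    have "(?u has_real_derivative
        (t * (2 * (t - x)) - (t * x - 4) * (- 2)) / (2 * (t - x) * (2 * (t - x)))) (at x)"
      using xt by (auto intro!: derivative_eq_intros)
    moreover have "2 * s\<^sup>2 / (2 * a * (2 * a)) = s\<^sup>2 / (2 * a\<^sup>2)" for a
      by (simp add: power2_eq_square)
    ultimately have du: "(?u has_real_derivative s\<^sup>2 / (2 * (t - x)\<^sup>2)) (at x)"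
      unfolding num by (simp only:)
    have "((\<lambda>x. arcsin (?u x)) has_real_derivative inverse (s * r / (2 * (t - x))) * (s\<^sup>2 / (2 * (t - x)\<^sup>2))) (at x)"
      unfolding u2[symmetric] by (rule DERIV_chain2[OF DERIV_arcsin[OF ux] du])
    moreover have "inverse (s * r / (2 * a)) * (s\<^sup>2 / (2 * a\<^sup>2)) = s / (r * a)" if "a > 0" for a
      using r(1) s(1) that by (simp add: field_simps power2_eq_square)
    ultimately have d3: "((\<lambda>x. arcsin (?u x)) has_real_derivative s / (r * (t - x))) (at x)"
      using xt by (simp only: diff_gt_0_iff_gt)
    have d1: "((\<lambda>x. arcsin (x / 2)) has_real_derivative 1 / r) (at x)"
      using x r by (auto intro!: derivative_eq_intros simp: r2)
    have d2: "((\<lambda>x. sqrt (4 - x\<^sup>2)) has_real_derivative - x / r) (at x)"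
      using x4 r by (auto intro!: derivative_eq_intros simp: r_def[symmetric] field_simps)
    have "(?F has_real_derivative t * (1 / r) - (- x / r) - s * (s / (r * (t - x)))) (at x)"
      unfolding s_def[symmetric] by (intro DERIV_diff DERIV_cmult d1 d2 d3)
    moreover have "t * (1 / r) - (- x / r) - s * (s / (r * (t - x))) = ((t + x) * (t - x) - s\<^sup>2) / (r * (t - x))"
      using r(1) xt by (simp add: divide_simps) (simp add: algebra_simps power2_eq_square)
    moreover have "(t + x) * (t - x) - s\<^sup>2 = r\<^sup>2"
      unfolding r s by (simp add: algebra_simps power2_eq_square)
    moreover have "r\<^sup>2 / (r * (t - x)) = r * (1 / (t - x))"
      using r(1) by (simp add: power2_eq_square)
    ultimately show "(?F has_vector_derivative sqrt (4 - x\<^sup>2) * (1 / (t - x))) (at x)"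
      unfolding r_def[symmetric] by (simp add: has_real_derivative_iff_has_vector_derivative)
  qed auto
  moreover have "?u 2 = 1" "?u (-2) = -1"
    using t by (auto simp: field_simps)
  ultimately show ?thesis
    by (simp add: arcsin_minus algebra_simps)
qed

lemma real_distribution_semicircle: "real_distribution semicircle_measure"
proof -
  have "has_bochner_integral semicircle_measure (\<lambda>_. 1::real) (2 * pi / (2 * pi))"
    by (rule has_bochner_integral_semicircle) (use semicircle_total in auto)
  then have "measure semicircle_measure (space semicircle_measure) = 1"
    by (auto simp: has_bochner_integral_iff)
  then have "emeasure semicircle_measure (space semicircle_measure) = 1"
    by (metis emeasure_eq_ennreal_measure ennreal_1 enn2real_top measure_def zero_neq_one)
  then have "prob_space semicircle_measure"
    by (rule prob_spaceI)
  then show ?thesis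
    by (simp add: real_distribution_def real_distribution_axioms_def semicircle_measure_def)
qed

lemma semicircle_support: "AE x in semicircle_measure. x \<in> {-2..2}"
  unfolding semicircle_measure_def
  by (subst AE_density) (auto simp: semicircle_density_def)

lemma semicircle_stieltjes:
  assumes "t > 2"
  shows "(\<integral>x. 1 / (t - x) \<partial>semicircle_measure) = (t - sqrt (t\<^sup>2 - 4)) / 2"
proof -
  have "has_bochner_integral semicircle_measure (\<lambda>x. 1 / (t - x)) (pi * (t - sqrt (t\<^sup>2 - 4)) / (2 * pi))"
    using assms by (intro has_bochner_integral_semicircle semicircle_stieltjes_integral) auto
  then show ?thesis
    by (simp add: has_bochner_integral_iff)
qed

section \<open>Nearly regular graphs\<close>

text \<open>An index is drawn uniformly, not a value, so repeated values count with their
  multiplicity.\<close>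

definition empirical_measure :: "nat \<Rightarrow> (nat \<Rightarrow> real) \<Rightarrow> real measure" where
  "empirical_measure n y = distr (measure_pmf (pmf_of_set {..<n})) borel y"

lemma
  assumes "n > 0"
  shows real_distribution_empirical_measure: "real_distribution (empirical_measure n y)"
    and cdf_empirical_measure: "cdf (empirical_measure n y) x = real (card {i. i < n \<and> y i \<le> x}) / real n"
    and integral_empirical_measure: "f \<in> borel_measurable borel \<Longrightarrow>
      integral\<^sup>L (empirical_measure n y) f = (\<Sum>i<n. f (y i)) / real n"
    and empirical_measure_support: "A \<in> sets borel \<Longrightarrow> (\<And>i. i < n \<Longrightarrow> y i \<in> A) \<Longrightarrow>
      AE x in empirical_measure n y. x \<in> A"
proof -
  have ne: "{..<n} \<noteq> {}"
    using assms by auto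
  show "real_distribution (empirical_measure n y)"
    unfolding real_distribution_def real_distribution_axioms_def empirical_measure_def
    by (auto intro: prob_space.prob_space_distr measure_pmf.prob_space_axioms)
  have "{..<n} \<inter> y -` {..x} = {i. i < n \<and> y i \<le> x}"
    by auto
  then show "cdf (empirical_measure n y) x = real (card {i. i < n \<and> y i \<le> x}) / real n"
    using ne by (simp add: cdf_def empirical_measure_def measure_distr measure_pmf_of_set)
  show "integral\<^sup>L (empirical_measure n y) f = (\<Sum>i<n. f (y i)) / real n"
    if "f \<in> borel_measurable borel"
    using ne that by (simp add: empirical_measure_def integral_distr integral_pmf_of_set)
  show "AE x in empirical_measure n y. x \<in> A" if "A \<in> sets borel" "\<And>i. i < n \<Longrightarrow> y i \<in> A"
    using ne that unfolding empirical_measure_def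
    by (subst AE_distr_iff) (auto simp: AE_measure_pmf_iff)
qed

text \<open>A finite measure on the line is determined by its cdf. This lets integrals against the
  measure rebuilt from the empirical cdf be read as averages over the roots.\<close>

lemma (in real_distribution) interval_measure_cdf: "interval_measure (cdf M) = M"
proof (rule cdf_unique')
  show "finite_borel_measure (interval_measure (cdf M))"
    by (rule finite_borel_measure_interval_measure[where m = 1])
       (simp_all add: cdf_nondecreasing cdf_is_right_cont cdf_lim_at_bot cdf_lim_at_top_prob)
  show "cdf (interval_measure (cdf M)) = cdf M"
    by (rule cdf_interval_measure)
       (simp_all add: cdf_nondecreasing cdf_is_right_cont cdf_lim_at_bot)
qed (rule finite_borel_measure_M)

section \<open>The empirical matching measure and its Stieltjes transform\<close>

definition matching_measure :: "real \<Rightarrow> 'a set \<Rightarrow> 'a set set \<Rightarrow> real measure" where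
  "matching_measure p V E =
     empirical_measure (card V) (\<lambda>i. matching_roots V E ! i / sqrt (real (card V) * p))"

text \<open>Real-rootedness enters here: the list of roots has exactly \<open>card V\<close>
  entries.\<close>

lemma emp_matching_cdf_eq:
  assumes "finite V" "E \<subseteq> complete_edges V" "V \<noteq> {}"
  shows "emp_matching_cdf p V E = cdf (matching_measure p V E)"
proof
  have "card V > 0"
    using assms by (simp add: card_gt_0_iff)
  then show "emp_matching_cdf p V E x = cdf (matching_measure p V E) x" for x
    unfolding matching_measure_def emp_matching_cdf_def
    by (simp add: cdf_empirical_measure matching_poly_roots(1)[OF assms(1,2)])
qed

text \<open>By \<open>matching_ratio_bounds\<close> the matching sum is positive at every point
  beyond \<open>b\<close>, and the parity symmetry transfers this to the negative side.\<close>

lemma matching_roots_bound: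
  fixes \<Delta> b :: real
  assumes fin: "finite V" and E: "E \<subseteq> complete_edges V"
    and deg: "\<forall>v\<in>V. real (card (neighbours E V v)) \<le> \<Delta>"
    and b: "b > 0" "4 * \<Delta> \<le> b\<^sup>2" and i: "i < card V"
  shows "\<bar>matching_roots V E ! i\<bar> \<le> b"
proof (rule ccontr)
  let ?x = "matching_roots V E ! i"
  assume "\<not> \<bar>?x\<bar> \<le> b"
  then have x: "\<bar>?x\<bar> > b"
    by simp
  then have "b\<^sup>2 \<le> \<bar>?x\<bar>\<^sup>2"
    using b by (intro power_mono) auto
  with b have "4 * \<Delta> \<le> \<bar>?x\<bar>\<^sup>2"
    by linarith
  then have "matching_sum E V \<bar>?x\<bar> > 0"
    using matching_ratio_bounds[OF fin complete_edges_card[OF E] _ deg] x b by auto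
  then have "matching_sum E V ?x \<noteq> 0"
    using matching_sum_uminus[OF fin complete_edges_card[OF E], of ?x] by (auto simp: abs_if split: if_splits)
  moreover have "?x \<in> set (matching_roots V E)"
    using i matching_poly_roots(1)[OF fin E] by simp
  then have "matching_sum E V ?x = 0"
    unfolding poly_matching_poly[OF fin E, symmetric] matching_poly_roots(2)[OF fin E] poly_prod_linear
    by (auto simp: prod_list_zero_iff)
  ultimately show False
    by simp
qed

text \<open>At \<open>z = t * sqrt d\<close> the rescaled Stieltjes transform is an average of
  ratios, each close to \<open>\<sigma>\<close>. The three errors come from stopping after
  \<open>K\<close> unrollings, from the irregularity of the degrees, and from the up to
  \<open>K\<close> deleted vertices.\<close>

lemma matching_measure_stieltjes_close:
  fixes p \<eta> t :: real
  assumes fin: "finite V" and E: "E \<subseteq> complete_edges V" and "V \<noteq> {}"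
    and \<eta>: "0 \<le> \<eta>" "\<eta> \<le> 1" and p: "p > 0" and t: "t \<ge> 4"
  defines "d \<equiv> real (card V) * p"
  assumes deg: "\<forall>v\<in>V. \<bar>real (card (neighbours E V v)) - d\<bar> \<le> \<eta> * d"
  shows "\<bar>(\<integral>x. 1 / (t - x) \<partial>matching_measure p V E) - (t - sqrt (t\<^sup>2 - 4)) / 2\<bar>
    \<le> (1 / 2) ^ K + \<eta> + real K / d"
proof -
  define n where "n = card V"
  have n: "n > 0"
    using \<open>V \<noteq> {}\<close> fin by (simp add: n_def card_gt_0_iff)
  have d: "d > 0"
    using n p by (simp add: d_def n_def)
  define z where "z = t * sqrt d"
  have z: "z > 0" "z\<^sup>2 = t\<^sup>2 * d"
    using t d by (simp_all add: z_def power_mult_distrib)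
  have t16: "t\<^sup>2 \<ge> 16"
    using power_mono[of 4 t 2] t by simp
  define r where "r = sqrt (t\<^sup>2 - 4)"
  \<comment> \<open>The smaller solution of \<open>s * (t - s) = 1\<close>; dividing it by
    \<open>sqrt d\<close> solves the equation for \<open>\<sigma>\<close> at
    \<open>z\<close>.\<close>
  define s where "s = (t - r) / 2"
  define \<sigma> where "\<sigma> = s / sqrt d"
  have r: "0 \<le> r" "r\<^sup>2 = t\<^sup>2 - 4"
    using t16 by (auto simp: r_def)
  have "r < t"
    using r t by (intro power2_less_imp_less[of r t]) auto
  then have s: "s > 0" "t - s \<ge> t / 2"
    using r by (auto simp: s_def)
  have s1: "s * (t - s) = 1"
    using r(2) by (simp add: s_def field_simps power2_eq_square)
  have "s * (t / 2) \<le> 1"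
    using mult_left_mono[OF s(2), of s] s(1) s1 by simp
  then have s2: "s \<le> 2 / t"
    using t by (simp add: field_simps)
  have sqd: "sqrt d > 0" "sqrt d * sqrt d = d"
    using d by auto
  have \<sigma>: "0 < \<sigma>" "\<sigma> \<le> 2 / z" "\<sigma> * (z - d * \<sigma>) = 1"
  proof -
    show "0 < \<sigma>"
      using s sqd by (simp add: \<sigma>_def)
    show "\<sigma> \<le> 2 / z"
      using s2 sqd t by (simp add: \<sigma>_def z_def field_simps)
    have "d * \<sigma> = s * sqrt d"
      using sqd by (simp add: \<sigma>_def field_simps)
    then have "z - d * \<sigma> = (t - s) * sqrt d"
      by (simp add: z_def algebra_simps)
    then show "\<sigma> * (z - d * \<sigma>) = 1"
      using s1 sqd by (simp add: \<sigma>_def)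
  qed
  \<comment> \<open>Since \<open>\<eta> \<le> 1\<close>, the degree bound \<open>\<Delta>\<close>
    can be taken as \<open>2 * d\<close>.\<close>
  have "\<eta> * d \<le> 1 * d"
    using \<eta> d by (intro mult_right_mono) auto
  then have deg2: "\<forall>v\<in>V. real (card (neighbours E V v)) \<le> 2 * d"
    using deg by fastforce
  have z8: "4 * (2 * d) < z\<^sup>2"
    using t16 d mult_right_mono[of 16 "t\<^sup>2" d] unfolding z by linarith
  have pos: "matching_sum E V z > 0"
    using matching_ratio_bounds[OF fin complete_edges_card[OF E] z(1) deg2] z8 by simp
  define q where "q = 4 * (2 * d) / z\<^sup>2"
  define \<epsilon> where "\<epsilon> = 4 * (\<eta> * d + real K) / z\<^sup>2"
  have "q = 8 / t\<^sup>2"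
    using d by (simp add: q_def z)
  \<comment> \<open>Here \<open>t \<ge> 4\<close> makes the contraction factor at most 1/2.\<close>
  moreover have "8 / t\<^sup>2 \<le> 8 / 16"
    using t16 by (intro divide_left_mono) auto
  ultimately have q: "0 \<le> q" "q \<le> 1 / 2"
    by auto
  have "\<epsilon> = 4 * (\<eta> + real K / d) / t\<^sup>2"
    using d by (simp add: \<epsilon>_def z field_simps)
  also have "\<dots> \<le> 4 * (\<eta> + real K / d) / 16"
    using t16 \<eta> d by (intro divide_left_mono) auto
  finally have \<epsilon>: "\<epsilon> \<le> (\<eta> + real K / d) / 4"
    by simp
  have \<epsilon>0: "0 \<le> \<epsilon>"
    using \<eta> d by (simp add: \<epsilon>_def)
  \<comment> \<open>The unrolling starts with no vertex deleted and all \<open>K\<close> steps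
    left.\<close>
  have approx: "\<bar>matching_ratio E V z v - \<sigma>\<bar> \<le> 2 / z * (q ^ K + \<epsilon> / (1 - q))" if "v \<in> V" for v
    unfolding q_def \<epsilon>_def
    by (rule matching_ratio_approx[OF fin complete_edges_card[OF E] z(1) deg2 z8 _ deg _ \<sigma>])
       (use d \<eta> that in auto)
  have "q ^ K \<le> (1 / 2) ^ K"
    using q by (intro power_mono) auto
  moreover have "\<epsilon> / (1 - q) \<le> \<epsilon> / (1 / 2)"
    using q \<epsilon>0 by (intro divide_left_mono) auto
  moreover have "0 \<le> real K / d"
    using d by simp
  moreover have "x + y \<le> b + \<eta> + k" if "x \<le> b" "y \<le> \<epsilon> / (1 / 2)" "0 \<le> k" "\<epsilon> \<le> (\<eta> + k) / 4"
    for x y b k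
    using that \<eta> by simp
  ultimately have "q ^ K + \<epsilon> / (1 - q) \<le> (1 / 2) ^ K + \<eta> + real K / d"
    using \<epsilon> by blast
  then have "2 / z * (q ^ K + \<epsilon> / (1 - q)) \<le> 2 / z * ((1 / 2) ^ K + \<eta> + real K / d)"
    using z(1) by (intro mult_left_mono) auto
  with approx have R: "\<bar>matching_ratio E V z v - \<sigma>\<bar> \<le> 2 / z * ((1 / 2) ^ K + \<eta> + real K / d)" if "v \<in> V" for v
    using that order.trans by blast
  have "(\<integral>x. 1 / (t - x) \<partial>matching_measure p V E)
      = (\<Sum>i<n. 1 / (t - matching_roots V E ! i / sqrt d)) / real n"
    unfolding matching_measure_def n_def[symmetric] using n
    by (subst integral_empirical_measure) (simp_all add: d_def n_def)
  also have "(\<Sum>i<n. 1 / (t - matching_roots V E ! i / sqrt d))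
      = (\<Sum>i<n. sqrt d * (1 / (z - matching_roots V E ! i)))"
  proof (rule sum.cong[OF refl])
    fix i
    have "z - x = sqrt d * (t - x / sqrt d)" for x
      using sqd by (simp add: z_def algebra_simps)
    then show "1 / (t - matching_roots V E ! i / sqrt d) = sqrt d * (1 / (z - matching_roots V E ! i))"
      using sqd by simp
  qed
  also have "\<dots> = sqrt d * (\<Sum>x\<leftarrow>matching_roots V E. 1 / (z - x))"
    by (simp add: sum_list_sum_nth atLeast0LessThan matching_poly_roots(1)[OF fin E] n_def
        sum_distrib_left)
  also have "(\<Sum>x\<leftarrow>matching_roots V E. 1 / (z - x)) = (\<Sum>v\<in>V. matching_ratio E V z v)"
    using pos by (intro matching_roots_stieltjes fin E) simp
  finally have int: "(\<integral>x. 1 / (t - x) \<partial>matching_measure p V E)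
      = sqrt d / real n * (\<Sum>v\<in>V. matching_ratio E V z v)"
    by simp
  have "s = sqrt d / real n * (\<Sum>v\<in>V. \<sigma>)"
    using n sqd by (simp add: \<sigma>_def n_def)
  then have "\<bar>(\<integral>x. 1 / (t - x) \<partial>matching_measure p V E) - s\<bar>
      = sqrt d / real n * \<bar>\<Sum>v\<in>V. matching_ratio E V z v - \<sigma>\<bar>"
    unfolding int using sqd n by (simp only: sum_subtractf right_diff_distrib[symmetric] abs_mult) simp
  also have "\<dots> \<le> sqrt d / real n * (real n * (2 / z * ((1 / 2) ^ K + \<eta> + real K / d)))"
    unfolding n_def using R sqd
    by (intro mult_left_mono order.trans[OF sum_abs] sum_bounded_above) auto
  \<comment> \<open>The \<open>sqrt d\<close> inside \<open>z\<close> cancels the one from the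
    scaling, and \<open>2 / t\<close> is at most 1.\<close>
  also have "\<dots> = 2 / t * ((1 / 2) ^ K + \<eta> + real K / d)"
    using n sqd t by (simp add: z_def)
  also have "\<dots> \<le> 1 * ((1 / 2) ^ K + \<eta> + real K / d)"
    using t \<eta> d by (intro mult_right_mono) auto
  finally show ?thesis
    by (simp add: s_def r_def)
qed

text \<open>A deterministic statement: near regularity eventually confines the scaled roots to a
  fixed interval and makes the Stieltjes transforms converge for \<open>t \<ge> 4\<close>, which
  fixes the limit.\<close>

theorem nearly_regular_semicircle:
  fixes p :: real and g :: "nat \<Rightarrow> nat set set" and f :: "real \<Rightarrow> real"
  assumes p: "p > 0" and g: "\<And>n. g n \<subseteq> complete_edges {..<n}"
    and deg: "\<And>\<eta>. \<eta> > 0 \<Longrightarrow> \<forall>\<^sub>F n in sequentially.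
      \<forall>v<n. \<bar>real (card (neighbours (g n) {..<n} v)) - real n * p\<bar> \<le> \<eta> * (real n * p)"
  shows "weak_conv (\<lambda>n. emp_matching_cdf p {..<n} (g n)) (cdf semicircle_measure)"
    and "continuous_on UNIV f \<Longrightarrow>
      (\<lambda>n. integral\<^sup>L (interval_measure (emp_matching_cdf p {..<n} (g n))) f)
        \<longlonglongrightarrow> integral\<^sup>L semicircle_measure f"
proof -
  \<comment> \<open>Degrees of at most \<open>2 * n * p\<close> confine the roots to
    \<open>sqrt (8 * n * p)\<close>, and \<open>8 \<le> 3\<^sup>2\<close>.\<close>
  define ok where "ok n \<longleftrightarrow> n > 0 \<and> (\<forall>i<n. \<bar>matching_roots {..<n} (g n) ! i / sqrt (real n * p)\<bar> \<le> 3)" for n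
  \<comment> \<open>A point mass at 0 replaces the finitely many exceptional measures,
    \<open>n = 0\<close> included, so that the locale assumptions hold for every \<open>n\<close>
    and the limit is unchanged.\<close>
  define \<mu> where "\<mu> n = (if ok n then matching_measure p {..<n} (g n) else return borel 0)" for n
  have "\<forall>\<^sub>F n in sequentially. n > (0::nat)"
    by (rule eventually_gt_at_top)
  with deg[OF zero_less_one] have ev_ok: "\<forall>\<^sub>F n in sequentially. ok n"
  proof eventually_elim
    case (elim n)
    let ?d = "real n * p"
    have d: "?d > 0"
      using elim p by simp
    have deg2: "\<forall>v\<in>{..<n}. real (card (neighbours (g n) {..<n} v)) \<le> 2 * ?d"
      using elim(1) by fastforce
    have "\<bar>matching_roots {..<n} (g n) ! i\<bar> \<le> 3 * sqrt ?d" if "i < n" for i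
      by (rule matching_roots_bound[OF _ g deg2]) (use p d that in \<open>auto simp: power_mult_distrib\<close>)
    then show ?case
      using elim d by (simp add: ok_def abs_divide pos_divide_le_eq)
  qed
  interpret interval_distributions \<mu> semicircle_measure 3
  proof (rule interval_distributions.intro)
    show "real_distribution (\<mu> n)" for n
    proof (cases "ok n")
      case True
      then show ?thesis
        by (simp add: \<mu>_def ok_def matching_measure_def real_distribution_empirical_measure)
    next
      case False
      then show ?thesis
        by (simp add: \<mu>_def real_distribution_def real_distribution_axioms_def prob_space_return)
    qed
    show "AE x in \<mu> n. x \<in> {-3..3}" for n
    proof (cases "ok n")
      case True
      have "y \<in> {-3..3}" if "\<bar>y\<bar> \<le> 3" for y :: real
        using that by auto
      with True have "n > 0" "\<And>i. i < n \<Longrightarrow> matching_roots {..<n} (g n) ! i / sqrt (real n * p) \<in> {-3..3}"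
        unfolding ok_def by blast+
      with True show ?thesis
        unfolding \<mu>_def matching_measure_def
        by (simp only: if_True card_lessThan) (rule empirical_measure_support, simp_all)
    next
      case False
      have "AE x in return borel 0. x \<in> {-3..3::real}"
        by (subst AE_return) simp_all
      with False show ?thesis
        by (simp only: \<mu>_def if_False)
    qed
    show "AE x in semicircle_measure. x \<in> {-3..3}"
      using semicircle_support by (rule eventually_mono) auto
  qed (rule real_distribution_semicircle)
  have st: "(\<lambda>n. \<integral>x. 1 / (t - x) \<partial>\<mu> n) \<longlonglongrightarrow> (\<integral>x. 1 / (t - x) \<partial>semicircle_measure)" if t: "t \<ge> 4" for t
  proof (rule tendstoI)
    fix e :: real assume "e > 0"
    \<comment> \<open>The order of choices matters: first \<open>K\<close>, then the tolerance
      \<open>\<eta>\<close>, and finally \<open>n\<close> so large that \<open>K / (n * p)\<close>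
      is small.\<close>
    obtain K where K: "(1 / 2 :: real) ^ K < e / 3"
      using real_arch_pow_inv[of "e / 3" "1 / 2"] \<open>e > 0\<close> by auto
    define \<eta> where "\<eta> = min 1 (e / 3)"
    have \<eta>: "0 < \<eta>" "\<eta> \<le> 1" "\<eta> \<le> e / 3"
      using \<open>e > 0\<close> by (auto simp: \<eta>_def)
    have "(\<lambda>n. real K / p / real n) \<longlonglongrightarrow> 0"
      by (rule lim_const_over_n)
    then have "\<forall>\<^sub>F n in sequentially. real K / p / real n < e / 3"
      using \<open>e > 0\<close> by (intro order_tendstoD) auto
    with deg[OF \<eta>(1)] ev_ok
    show "\<forall>\<^sub>F n in sequentially.
        dist (\<integral>x. 1 / (t - x) \<partial>\<mu> n) (\<integral>x. 1 / (t - x) \<partial>semicircle_measure) < e"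
    proof eventually_elim
      case (elim n)
      have "\<bar>(\<integral>x. 1 / (t - x) \<partial>matching_measure p {..<n} (g n)) - (t - sqrt (t\<^sup>2 - 4)) / 2\<bar>
          \<le> (1 / 2) ^ K + \<eta> + real K / (real (card {..<n}) * p)"
        by (rule matching_measure_stieltjes_close) (use elim \<eta> p t g in \<open>auto simp: ok_def\<close>)
      also have "real K / (real (card {..<n}) * p) < e / 3"
        using elim(3) by (simp add: mult.commute)
      also have "(1 / 2) ^ K + \<eta> + e / 3 \<le> e"
        using add_mono[OF less_imp_le[OF K] \<eta>(3)] by simp
      finally show ?case
        using elim(2) t by (simp add: \<mu>_def dist_real_def semicircle_stieltjes)
    qed
  qed
  have conv: "(\<lambda>n. integral\<^sup>L (\<mu> n) f) \<longlonglongrightarrow> integral\<^sup>L semicircle_measure f" if "continuous_on UNIV f" for f :: "real \<Rightarrow> real"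
    by (rule stieltjes_conv_imp_integral_conv[where b = 4]) (use st that in auto)
  have cdf: "\<forall>\<^sub>F n in sequentially. emp_matching_cdf p {..<n} (g n) = cdf (\<mu> n)"
    using ev_ok
  proof eventually_elim
    case (elim n)
    then have "{..<n} \<noteq> {}"
      by (auto simp: ok_def)
    then show ?case
      using elim emp_matching_cdf_eq[OF _ g] by (simp add: \<mu>_def)
  qed
  have "weak_conv_m \<mu> semicircle_measure"
    by (rule integral_bdd_continuous_conv_imp_weak_conv[OF distr])
       (intro conv continuous_at_imp_continuous_on, blast)
  have lim: "(\<lambda>n. emp_matching_cdf p {..<n} (g n) x) \<longlonglongrightarrow> L" if "(\<lambda>n. cdf (\<mu> n) x) \<longlonglongrightarrow> L" for x L
    by (rule Lim_transform_eventually[OF that]) (rule eventually_mono[OF cdf], simp)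
  from \<open>weak_conv_m \<mu> semicircle_measure\<close>
  show "weak_conv (\<lambda>n. emp_matching_cdf p {..<n} (g n)) (cdf semicircle_measure)"
    unfolding weak_conv_m_def weak_conv_def using lim by blast
  show "(\<lambda>n. integral\<^sup>L (interval_measure (emp_matching_cdf p {..<n} (g n))) f)
      \<longlonglongrightarrow> integral\<^sup>L semicircle_measure f" if "continuous_on UNIV f"
  proof (rule Lim_transform_eventually[OF conv[OF that]])
    show "\<forall>\<^sub>F n in sequentially. integral\<^sup>L (\<mu> n) f
        = integral\<^sup>L (interval_measure (emp_matching_cdf p {..<n} (g n))) f"
      using cdf
      by (rule eventually_mono) (simp add: real_distribution.interval_measure_cdf[OF distr(1)])
  qed
qed

section \<open>Degrees of random graphs\<close>

text \<open>A preimage under an indicator is empty, the event, its complement or the whole space, so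
  it lies in the sigma-algebra generated by the event, to which independence extends.\<close>

lemma (in prob_space) indep_vars_indicator:
  assumes "indep_events A I"
  shows "indep_vars (\<lambda>_. borel) (\<lambda>i. indicator (A i) :: 'a \<Rightarrow> real) I"
proof -
  have A: "A i \<in> events" if "i \<in> I" for i
    using assms that by (auto simp: indep_events_def)
  have "indep_sets (\<lambda>i. sigma_sets (space M) {A i}) I"
    using assms unfolding indep_events_def_alt
    by (rule indep_sets_sigma) (auto simp: Int_stable_def)
  then have "indep_sets (\<lambda>i. {(indicator (A i) :: 'a \<Rightarrow> real) -` B \<inter> space M | B. B \<in> sets borel}) I"
  proof (rule indep_sets_mono_sets)
    fix i assume i: "i \<in> I"
    interpret S: sigma_algebra "space M" "sigma_sets (space M) {A i}"
      using A[OF i] sets.sets_into_space by (intro sigma_algebra_sigma_sets) auto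
    have mem: "A i \<in> sigma_sets (space M) {A i}"
      by auto
    have "(indicator (A i) :: 'a \<Rightarrow> real) -` B \<inter> space M \<in> sigma_sets (space M) {A i}" for B
    proof -
      have "(indicator (A i) :: 'a \<Rightarrow> real) -` B \<inter> space M
          = (if 1 \<in> B then A i else {}) \<union> (if 0 \<in> B then space M - A i else {})"
        using sets.sets_into_space[OF A[OF i]] by (auto simp: indicator_def of_bool_def split: if_splits)
      also have "\<dots> \<in> sigma_sets (space M) {A i}"
        using mem S.compl_sets[OF mem] by (intro S.Un) auto
      finally show ?thesis .
    qed
    then show "{(indicator (A i) :: 'a \<Rightarrow> real) -` B \<inter> space M | B. B \<in> sets borel}
        \<subseteq> sigma_sets (space M) {A i}"
      by blast
  qed
  then show ?thesis
    unfolding indep_vars_def2 using A by auto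
qed

text \<open>Hoeffding's inequality for variables in the unit interval: the squared ranges sum to
  \<open>card I\<close>.\<close>

lemma (in prob_space) binomial_sum_deviation:
  assumes indep: "indep_events A I" and fin: "finite I" "I \<noteq> {}"
    and p: "\<And>i. i \<in> I \<Longrightarrow> prob (A i) = p" and "a \<ge> 0"
  shows "prob {\<omega>\<in>space M. \<bar>(\<Sum>i\<in>I. indicator (A i) \<omega>) - real (card I) * p\<bar> \<ge> a}
    \<le> 2 * exp (-2 * a\<^sup>2 / real (card I))"
proof -
  have A: "A i \<in> events" if "i \<in> I" for i
    using indep that by (auto simp: indep_events_def)
  have sum: "(\<Sum>i\<in>I. expectation (indicator (A i))) = real (card I) * p"
    using p A by simp
  interpret H: Hoeffding_ineq M I "\<lambda>i. indicator (A i)" "\<lambda>_. 0" "\<lambda>_. 1" "real (card I) * p"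
    by unfold_locales (use fin sum indep_vars_indicator[OF indep] in \<open>auto simp: indicator_def\<close>)
  have "(\<Sum>i\<in>I. (1 - 0)\<^sup>2 :: real) > 0"
    using fin by (simp add: card_gt_0_iff)
  from H.Hoeffding_ineq_abs_ge[OF \<open>a \<ge> 0\<close> this] show ?thesis
    by simp
qed

text \<open>Sending \<open>u\<close> to \<open>{u, v}\<close> pairs neighbours with incident edges,
  which turns a degree into a sum of edge indicators.\<close>

lemma card_neighbours:
  assumes E: "E \<subseteq> complete_edges V" and fin: "finite V" and v: "v \<in> V"
  shows "card (neighbours E V v) = card {e\<in>E. v \<in> e}"
proof (rule bij_betw_same_card[of "\<lambda>u. {u, v}"], rule bij_betwI')
  fix u assume "u \<in> neighbours E V v"
  then show "{u, v} \<in> {e\<in>E. v \<in> e}"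
    by (auto simp: neighbours_def)
next
  fix e assume e: "e \<in> {e\<in>E. v \<in> e}"
  then have "card e = 2" "e \<subseteq> V"
    using E by (auto simp: complete_edges_def)
  then obtain u where "e = {u, v}"
    using e by (auto simp: card_2_iff)
  then show "\<exists>u\<in>neighbours E V v. e = {u, v}"
    using e \<open>e \<subseteq> V\<close> by (auto simp: neighbours_def)
qed (auto simp: doubleton_eq_iff)

lemma card_complete_star:
  assumes "finite V" "v \<in> V"
  shows "card {e\<in>complete_edges V. v \<in> e} = card V - 1"
proof -
  have "neighbours (complete_edges V) V v = V - {v}"
    using assms by (auto simp: neighbours_def complete_edges_def)
  then show ?thesis
    using card_neighbours[of "complete_edges V" V v] assms by simp
qed

lemma finite_complete_edges: "finite V \<Longrightarrow> finite (complete_edges V)"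
  by (rule finite_subset[of _ "Pow V"]) (auto simp: complete_edges_def)

text \<open>The \<open>n - 1\<close> possible edges at \<open>v\<close> are independent, so the
  degree has mean \<open>(n - 1) * p\<close> and Hoeffding's inequality applies;
  \<open>n \<ge> 2\<close> makes this star nonempty.\<close>

lemma erdos_renyi_degree_deviation:
  assumes er: "erdos_renyi M n p G" and v: "v < n" and n: "n \<ge> 2" and a: "a \<ge> 0"
  defines "B \<equiv> {\<omega>\<in>space M. \<bar>real (card (neighbours (G \<omega>) {..<n} v)) - real (n - 1) * p\<bar> \<ge> a}"
  shows "B \<in> sets M" "measure M B \<le> 2 * exp (-2 * a\<^sup>2 / real n)"
proof -
  interpret prob_space M
    using er by (simp add: erdos_renyi_def)
  let ?A = "\<lambda>e. {\<omega>\<in>space M. e \<in> G \<omega>}" and ?I = "{e\<in>complete_edges {..<n}. v \<in> e}"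
  have indep: "indep_events ?A ?I"
    using er by (auto simp: erdos_renyi_def indep_events_def)
  have A: "?A e \<in> events" if "e \<in> ?I" for e
    using indep that by (auto simp: indep_events_def)
  have finI: "finite ?I"
    by (simp add: finite_complete_edges)
  have cardI: "card ?I = n - 1"
    using card_complete_star[of "{..<n}" v] v by simp
  have deg: "real (card (neighbours (G \<omega>) {..<n} v)) = (\<Sum>e\<in>?I. indicator (?A e) \<omega>)"
    if "\<omega> \<in> space M" for \<omega>
  proof -
    have G: "G \<omega> \<subseteq> complete_edges {..<n}"
      using er that by (auto simp: erdos_renyi_def)
    have "(\<Sum>e\<in>?I. indicator (?A e) \<omega>) = (\<Sum>e\<in>?I. if e \<in> G \<omega> then 1 else 0 :: real)"
      using that by (intro sum.cong) auto
    also have "\<dots> = real (card {e\<in>?I. e \<in> G \<omega>})"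
      using finI by (simp add: sum.If_cases Collect_conj_eq Int_assoc)
    also have "{e\<in>?I. e \<in> G \<omega>} = {e\<in>G \<omega>. v \<in> e}"
      using G by auto
    finally show ?thesis
      using card_neighbours[OF G, of v] v by simp
  qed
  have B: "B = {\<omega>\<in>space M. \<bar>(\<Sum>e\<in>?I. indicator (?A e) \<omega>) - real (card ?I) * p\<bar> \<ge> a}"
    unfolding B_def cardI using deg by auto
  have [measurable]: "(\<lambda>\<omega>. \<Sum>e\<in>?I. indicator (?A e) \<omega> :: real) \<in> borel_measurable M"
    using A by (intro borel_measurable_sum borel_measurable_indicator)
  show "B \<in> sets M"
    unfolding B by measurable
  have "?I \<noteq> {}"
  proof
    assume "?I = {}"
    then have "card ?I = 0"
      by (simp only: card.empty)
    with cardI n show False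
      by linarith
  qed
  then have "measure M B \<le> 2 * exp (-2 * a\<^sup>2 / real (card ?I))"
    unfolding B using er
    by (intro binomial_sum_deviation indep finI a) (auto simp: erdos_renyi_def)
  \<comment> \<open>Replacing \<open>n - 1\<close> by \<open>n\<close> weakens the bound but makes
    it geometric in \<open>n\<close> later.\<close>
  also have "\<dots> \<le> 2 * exp (-2 * a\<^sup>2 / real n)"
    unfolding cardI using n by (simp add: frac_le)
  finally show "measure M B \<le> 2 * exp (-2 * a\<^sup>2 / real n)" .
qed

text \<open>A union bound over the \<open>n\<close> vertices leaves a summable failure probability,
  so the first Borel-Cantelli lemma applies whatever the joint law of the graphs for different
  \<open>n\<close>.\<close>

lemma erdos_renyi_nearly_regular:
  fixes p \<eta> :: real
  assumes p: "0 < p" and "prob_space M" and er: "\<And>n. erdos_renyi M n p (G n)" and \<eta>: "\<eta> > 0"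
  shows "AE \<omega> in M. \<forall>\<^sub>F n in sequentially.
    \<forall>v<n. \<bar>real (card (neighbours (G n \<omega>) {..<n} v)) - real n * p\<bar> \<le> \<eta> * (real n * p)"
proof -
  interpret prob_space M by fact
  \<comment> \<open>Half of the tolerance; the other half absorbs the gap \<open>p\<close> between
    the mean \<open>(n - 1) * p\<close> and \<open>n * p\<close>. With this value the Hoeffding
    bound is \<open>2 * r ^ n\<close>.\<close>
  define a where "a n = \<eta> * p / 2 * real n" for n
  define D where "D n v = {\<omega>\<in>space M.
    \<bar>real (card (neighbours (G n \<omega>) {..<n} v)) - real (n - 1) * p\<bar> \<ge> a n}" for n v
  define B where "B n = (if n \<ge> 2 then \<Union>v<n. D n v else {})" for n
  define r where "r = exp (- (\<eta> * p)\<^sup>2 / 2)"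
  have r: "0 < r" "r < 1"
    using p \<eta> by (auto simp: r_def)
  have D: "D n v \<in> events" "prob (D n v) \<le> 2 * r ^ n" if "n \<ge> 2" "v < n" for n v
  proof -
    note dev = erdos_renyi_degree_deviation[OF er[of n] that(2,1), of "a n", folded D_def]
    have "a n \<ge> 0"
      using p \<eta> by (simp add: a_def)
    then show "D n v \<in> events"
      by (rule dev)
    have "exp (-2 * (a n)\<^sup>2 / real n) = r ^ n"
      unfolding r_def exp_of_nat_mult[symmetric] using that
      by (simp add: a_def power2_eq_square)
    then show "prob (D n v) \<le> 2 * r ^ n"
      using dev(2)[OF \<open>a n \<ge> 0\<close>] by simp
  qed
  have B: "B n \<in> events" for n
    unfolding B_def using D by auto
  \<comment> \<open>The factor \<open>Suc n\<close> matches the series of the derivative of the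
    geometric series and also covers the empty events for \<open>n < 2\<close>.\<close>
  have bound: "prob (B n) \<le> 2 * (real (Suc n) * r ^ n)" for n
  proof (cases "n \<ge> 2")
    case True
    have "prob (B n) \<le> (\<Sum>v<n. prob (D n v))"
      unfolding B_def using True D by (auto intro!: finite_measure_subadditive_finite)
    also have "\<dots> \<le> real (card {..<n}) * (2 * r ^ n)"
      by (rule sum_bounded_above) (use D True in auto)
    also have "\<dots> \<le> 2 * (real (Suc n) * r ^ n)"
      using r by (simp add: mult_right_mono)
    finally show ?thesis .
  next
    case False
    then show ?thesis
      using r by (simp add: B_def)
  qed
  have "summable (\<lambda>n. 2 * (real (Suc n) * r ^ n))"
    using geometric_deriv_sums[of r] r by (intro summable_mult) (simp add: sums_iff)
  then have "summable (\<lambda>n. prob (B n))"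
    by (rule summable_comparison_test'[where N = 0])
       (simp only: real_norm_def abs_of_nonneg[OF measure_nonneg] bound)
  then have "AE \<omega> in M. \<forall>\<^sub>F n in sequentially. \<omega> \<in> space M - B n"
    by (intro borel_cantelli_AE1 B) (auto simp: emeasure_eq_measure)
  moreover have "\<forall>\<^sub>F n in sequentially.
      \<forall>v<n. \<bar>real (card (neighbours (G n \<omega>) {..<n} v)) - real n * p\<bar> \<le> \<eta> * (real n * p)"
    if ev: "\<forall>\<^sub>F n in sequentially. \<omega> \<in> space M - B n" for \<omega>
  proof -
    \<comment> \<open>From \<open>n \<ge> 2 / \<eta>\<close> on, the gap \<open>p\<close> is at most
      half of the tolerance \<open>\<eta> * n * p\<close>.\<close>
    have "\<forall>\<^sub>F n in sequentially. n \<ge> max 2 (nat \<lceil>2 / \<eta>\<rceil>)"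
      by (rule eventually_ge_at_top)
    with ev show ?thesis
    proof eventually_elim
      case (elim n)
      have "2 / \<eta> \<le> real n"
        using elim(2) by linarith
      then have "2 \<le> \<eta> * real n"
        using \<eta> by (simp add: field_simps)
      then have n: "p \<le> \<eta> * (real n * p) / 2"
        using p mult_right_mono[of 2 "\<eta> * real n" p] by simp
      show ?case
      proof (intro allI impI)
        fix v assume "v < n"
        let ?d = "real (card (neighbours (G n \<omega>) {..<n} v))"
        have "\<omega> \<notin> D n v"
          using elim \<open>v < n\<close> by (auto simp: B_def)
        moreover have "a n = \<eta> * (real n * p) / 2"
          by (simp add: a_def)
        ultimately have "\<bar>?d - real (n - 1) * p\<bar> < \<eta> * (real n * p) / 2"
          using elim by (simp add: D_def not_le)
        moreover have "real (n - 1) * p = real n * p - p"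
          using elim by (simp add: of_nat_diff algebra_simps)
        ultimately show "\<bar>?d - real n * p\<bar> \<le> \<eta> * (real n * p)"
          using n p by linarith
      qed
    qed
  qed
  ultimately show ?thesis
    by (rule eventually_mono)
qed

section \<open>Almost sure convergence for random graphs\<close>

theorem theorem2p2:
  fixes p :: real and M :: "'w measure" and G :: "nat \<Rightarrow> 'w \<Rightarrow> nat set set"
  assumes "0 < p" and "p < 1"
    and "prob_space M"
    and "\<And>n. erdos_renyi M n p (G n)"
  shows "(AE \<omega> in M. weak_conv (\<lambda>n. emp_matching_cdf p {..<n} (G n \<omega>))
                               (cdf semicircle_measure)) \<and>
    (\<forall>f :: real \<Rightarrow> real. continuous_on UNIV f \<longrightarrow> bounded (range f) \<longrightarrow>
      (AE \<omega> in M.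
        (\<lambda>n. integral\<^sup>L (interval_measure (emp_matching_cdf p {..<n} (G n \<omega>))) f)
          \<longlonglongrightarrow> integral\<^sup>L semicircle_measure f))"
proof -
  \<comment> \<open>Countably many tolerances suffice, so a single null set serves every
    \<open>\<eta>\<close>.\<close>
  have "AE \<omega> in M. \<forall>k. \<forall>\<^sub>F n in sequentially. \<forall>v<n.
      \<bar>real (card (neighbours (G n \<omega>) {..<n} v)) - real n * p\<bar> \<le> 1 / real (Suc k) * (real n * p)"
    unfolding AE_all_countable
    by (intro allI erdos_renyi_nearly_regular assms) simp
  then have regular: "AE \<omega> in M. \<forall>\<eta>>0. \<forall>\<^sub>F n in sequentially. \<forall>v<n.
      \<bar>real (card (neighbours (G n \<omega>) {..<n} v)) - real n * p\<bar> \<le> \<eta> * (real n * p)"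
  proof (rule eventually_mono, intro allI impI)
    fix \<omega> and \<eta> :: real
    assume *: "\<forall>k. \<forall>\<^sub>F n in sequentially. \<forall>v<n.
      \<bar>real (card (neighbours (G n \<omega>) {..<n} v)) - real n * p\<bar> \<le> 1 / real (Suc k) * (real n * p)"
    assume "\<eta> > 0"
    then obtain k where "1 / real (Suc k) < \<eta>"
      using nat_approx_posE by blast
    then have "1 / real (Suc k) * (real n * p) \<le> \<eta> * (real n * p)" for n
      using assms(1) by (intro mult_right_mono) auto
    then show "\<forall>\<^sub>F n in sequentially. \<forall>v<n.
      \<bar>real (card (neighbours (G n \<omega>) {..<n} v)) - real n * p\<bar> \<le> \<eta> * (real n * p)"
      by (intro eventually_mono[OF *[rule_format, of k]]) (meson order_trans)
  qed
  \<comment> \<open>\<open>erdos_renyi\<close> constrains the graph only on \<open>space M\<close>,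
    which is why \<open>AE_space\<close> is combined with \<open>regular\<close> below.\<close>
  have sub: "G n \<omega> \<subseteq> complete_edges {..<n}" if "\<omega> \<in> space M" for n \<omega>
    using assms(4) that by (simp add: erdos_renyi_def)
  show ?thesis
  proof (intro conjI allI impI)
    show "AE \<omega> in M. weak_conv (\<lambda>n. emp_matching_cdf p {..<n} (G n \<omega>)) (cdf semicircle_measure)"
      using regular AE_space
      by eventually_elim (rule nearly_regular_semicircle(1)[OF assms(1) sub], simp_all)
  next
    fix f :: "real \<Rightarrow> real" assume f: "continuous_on UNIV f"
    show "AE \<omega> in M. (\<lambda>n. integral\<^sup>L (interval_measure (emp_matching_cdf p {..<n} (G n \<omega>))) f)
        \<longlonglongrightarrow> integral\<^sup>L semicircle_measure f"
      using regular AE_space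
      by eventually_elim (rule nearly_regular_semicircle(2)[OF assms(1) sub _ f], simp_all)
  qed
qed

end
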